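(* Let $n\ge 3$, let the edges of the complete graph $K_n$ carry independent weights with one common atomless law on $\mathbb{R}$, and let $T$ be the almost surely unique minimum spanning tree. Then the law of $T$ has the pairwise negative correlation property: for all distinct edges $e\ne f$ of $K_n$, $$\mathbf{P}(e\in T,\ f\in T)\le \mathbf{P}(e\in T)\,\mathbf{P}(f\in T).$$
   Context: The law of $T$ does not depend on the choice of the common atomless weight law, because $T$ depends only on the relative order of the weights. *)

theory Defs
  imports "HOL-Probability.Probability"
begin

text \<open>
  Undirected simple graphs are given by a vertex set and a set of two-element vertex sets.
  The notions \<open>forest\<close> and \<open>spanning_tree\<close> of the AFP entry Graph_Theory are not used: they
  refer to directed cycles, so that a pair of opposite arcs is already a cycle and an acyclically
  oriented triangle is a forest.
\<close>

definition complete_edges :: "nat \<Rightarrow> nat set set" where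
  "complete_edges n = {e. e \<subseteq> {..<n} \<and> card e = 2}"

definition edges_connect :: "'a set \<Rightarrow> 'a set set \<Rightarrow> bool" where
  "edges_connect V F \<longleftrightarrow> (\<forall>u\<in>V. \<forall>v\<in>V. (u, v) \<in> {(x, y). {x, y} \<in> F}\<^sup>*)"

text \<open>A cycle is the list of its vertices, without repeating the first one at the end.\<close>

definition edge_cycle :: "'a set set \<Rightarrow> 'a list \<Rightarrow> bool" where
  "edge_cycle F p \<longleftrightarrow> 3 \<le> length p \<and> distinct p \<and>
     (\<forall>i<length p. {p ! i, p ! (Suc i mod length p)} \<in> F)"

text \<open>Spanning trees of the complete graph on \<open>{..<n}\<close>, identified with their edge sets.\<close>

definition is_spanning_tree :: "nat \<Rightarrow> nat set set \<Rightarrow> bool" where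
  "is_spanning_tree n F \<longleftrightarrow>
     F \<subseteq> complete_edges n \<and> edges_connect {..<n} F \<and> \<not> (\<exists>p. edge_cycle F p)"

definition is_min_spanning_tree :: "nat \<Rightarrow> (nat set \<Rightarrow> real) \<Rightarrow> nat set set \<Rightarrow> bool" where
  "is_min_spanning_tree n w F \<longleftrightarrow>
     is_spanning_tree n F \<and> (\<forall>F'. is_spanning_tree n F' \<longrightarrow> sum w F \<le> sum w F')"

text \<open>Every measurable set of positive measure has a measurable subset of strictly smaller
  positive measure. For a law on the reals this says that all points have measure zero.\<close>

definition atomless :: "'a measure \<Rightarrow> bool" where
  "atomless \<mu> \<longleftrightarrow> (\<forall>A\<in>sets \<mu>. 0 < emeasure \<mu> A \<longrightarrow>
     (\<exists>B\<in>sets \<mu>. B \<subseteq> A \<and> 0 < emeasure \<mu> B \<and> emeasure \<mu> B < emeasure \<mu> A))"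

end

(*
Kruskal's algorithm on edges in uniformly random order adds, at each step, a uniformly random edge
between different components of the current forest.  Every edge lies in T with probability 2/n.
By symmetry only two pair probabilities occur, a for adjacent and b for disjoint edges, and
n a + n (n - 3) b / 4 = 1, so that both claims a <= 4 / n^2 and b <= 4 / n^2 are bounds
3 (n - 1) (n - 2) / n <= E S <= 4 (n - 1) (n - 2) / n  for  S = sum_v deg v (deg v - 1).

For a forest with k components of sizes s_1, ..., s_k the upper bound comes from the supermartingale
S + 8 (k - 1) - 4 (k - 1) (k + 2) / n, by Cauchy--Schwarz.  The lower bound comes from the submartingale
S + 8 (k - 1) - 4 sum_i 1 / s_i - (k - 2) (k + 3) / n, which is the conditional expectation of S for
the uniform spanning tree containing the forest; that it increases on average under Kruskal's dynamics
is the inequality sum_{i<j} s_i s_j / (s_i + s_j) <= k / (2 n) * sum_{i<j} s_i s_j.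
*)
theory Submission
  imports Defs
begin

section \<open>Linked vertices and minimum spanning trees\<close>

text \<open>Why the drift of S sees only component sizes: a tree component of size s has mean degree
  2 - 2/s, and a crossing edge has independent-looking uniform ends inside its two components.
  Joining sizes s and t therefore raises S by 8 - 4/s - 4/t on average, and 8 (k - 1) removes the 8.
  Averaged over crossing edges, 4/s + 4/t is at least 8k/n, with equality for equal sizes. This
  gives the quadratic of the upper potential, whose decrement at a merge is 8k/n. For the lower
  bound the same estimate points the wrong way, so the term in 1/s_i is carried along: its change
  cancels 4/s + 4/t and leaves only -4/(s + t). The average of 4/(s + t) is at most 2k/n, again with
  equality for equal sizes, and 2k/n is the decrement of the other quadratic. The constants in the
  quadratics make both potentials equal to S when k = 1. Probability enters only at the end: the
  martingale argument is an induction on sums over all edge orders, and atomlessness makes all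
  orders equally likely.\<close>

definition linked :: "'a set set \<Rightarrow> ('a \<times> 'a) set" where
  "linked F = {(x, y). {x, y} \<in> F}\<^sup>*"

lemma linked_refl [simp]: "(x, x) \<in> linked F"
  by (simp add: linked_def)

lemma linked_sym: "(x, y) \<in> linked F \<Longrightarrow> (y, x) \<in> linked F"
proof -
  have "sym {(x, y). {x, y} \<in> F}"
    by (auto simp: sym_def insert_commute)
  then show "(x, y) \<in> linked F \<Longrightarrow> (y, x) \<in> linked F"
    unfolding linked_def by (metis sym_rtrancl symD)
qed

lemma linked_trans: "(x, y) \<in> linked F \<Longrightarrow> (y, z) \<in> linked F \<Longrightarrow> (x, z) \<in> linked F"
  by (simp add: linked_def)

lemma linked_edge: "{x, y} \<in> F \<Longrightarrow> (x, y) \<in> linked F"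
  by (auto simp: linked_def)

lemma linked_subset:
  assumes "\<And>x y. {x, y} \<in> F \<Longrightarrow> (x, y) \<in> linked G"
  shows "linked F \<subseteq> linked G"
proof -
  have "linked F \<subseteq> (linked G)\<^sup>*"
    unfolding linked_def[of F] by (rule rtrancl_mono) (use assms in auto)
  then show ?thesis
    by (simp add: linked_def)
qed

lemma linked_mono: "F \<subseteq> G \<Longrightarrow> linked F \<subseteq> linked G"
  by (rule linked_subset) (auto intro: linked_edge)

lemma edges_connect_iff: "edges_connect V F \<longleftrightarrow> (\<forall>u\<in>V. \<forall>v\<in>V. (u, v) \<in> linked F)"
  by (simp add: edges_connect_def linked_def)

lemma edges_connect_pair: "edges_connect {a, b} F \<longleftrightarrow> (a, b) \<in> linked F"
  by (auto simp: edges_connect_iff intro: linked_sym)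

lemma linked_insert_self: "(a, b) \<in> linked F \<Longrightarrow> linked (insert {a, b} F) = linked F"
proof
  assume "(a, b) \<in> linked F"
  then show "linked (insert {a, b} F) \<subseteq> linked F"
    by (intro linked_subset) (auto simp: doubleton_eq_iff intro: linked_edge linked_sym)
qed (auto intro!: linked_mono)

text \<open>A walk needs the new edge at most once, in one of its two directions. This is the only
  tool used for tracking connectivity when an edge is added.\<close>

lemma linked_insert:
  "(x, y) \<in> linked (insert {a, b} F) \<longleftrightarrow>
     (x, y) \<in> linked F \<or> (x, a) \<in> linked F \<and> (b, y) \<in> linked F \<or>
     (x, b) \<in> linked F \<and> (a, y) \<in> linked F"
proof
  assume "(x, y) \<in> linked (insert {a, b} F)"
  then have "(x, y) \<in> {(x, y). {x, y} \<in> insert {a, b} F}\<^sup>*"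
    by (simp add: linked_def)
  then show "(x, y) \<in> linked F \<or> (x, a) \<in> linked F \<and> (b, y) \<in> linked F \<or>
     (x, b) \<in> linked F \<and> (a, y) \<in> linked F"
  proof (induction rule: rtrancl_induct)
    case (step y z)
    from step.hyps(2) consider "y = a" "z = b" | "y = b" "z = a" | "(y, z) \<in> linked F"
      by (auto simp: doubleton_eq_iff intro: linked_edge)
    then show ?case
    proof cases
      case 1
      then show ?thesis using step.IH
        by (meson linked_refl linked_sym linked_trans)
    next
      case 2
      then show ?thesis using step.IH
        by (meson linked_refl linked_sym linked_trans)
    next
      case 3
      then show ?thesis using step.IH
        by (meson linked_trans)
    qed
  qed simp
next
  have m: "linked F \<subseteq> linked (insert {a, b} F)"
    by (intro linked_mono) auto
  have e: "(a, b) \<in> linked (insert {a, b} F)"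
    by (simp add: linked_edge)
  show "(x, y) \<in> linked F \<or> (x, a) \<in> linked F \<and> (b, y) \<in> linked F \<or>
     (x, b) \<in> linked F \<and> (a, y) \<in> linked F \<Longrightarrow> (x, y) \<in> linked (insert {a, b} F)"
    using m e linked_sym[OF e] by (elim disjE conjE) (meson in_mono linked_trans)+
qed

lemma linked_path:
  assumes "(x, y) \<in> linked F"
  obtains p where "p \<noteq> []" "hd p = x" "last p = y" "distinct p"
    "\<And>i. Suc i < length p \<Longrightarrow> {p ! i, p ! Suc i} \<in> F"
proof -
  have "(x, y) \<in> {(x, y). {x, y} \<in> F}\<^sup>*"
    using assms by (simp add: linked_def)
  then have "\<exists>p. p \<noteq> [] \<and> hd p = x \<and> last p = y \<and> distinct p \<and>
      (\<forall>i. Suc i < length p \<longrightarrow> {p ! i, p ! Suc i} \<in> F)"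
  proof (induction rule: rtrancl_induct)
    case base
    show ?case by (rule exI[of _ "[x]"]) simp
  next
    case (step y z)
    then obtain p where p: "p \<noteq> []" "hd p = x" "last p = y" "distinct p"
      "\<forall>i. Suc i < length p \<longrightarrow> {p ! i, p ! Suc i} \<in> F" by blast
    show ?case
    proof (cases "z \<in> set p")
      case True
      then obtain j where j: "j < length p" "p ! j = z"
        by (auto simp: in_set_conv_nth)
      \<comment> \<open>The walk returns to a vertex already on the path; cutting the loop keeps the
        vertices distinct.\<close>
      have "last (take (Suc j) p) = z"
        using j by (simp add: take_Suc_conv_app_nth)
      then show ?thesis
        using p j by (intro exI[of _ "take (Suc j) p"]) auto
    next
      case False
      have "{(p @ [z]) ! i, (p @ [z]) ! Suc i} \<in> F" if "Suc i < length (p @ [z])" for i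
      proof (cases "Suc i < length p")
        case True
        then show ?thesis using p by (simp add: nth_append)
      next
        case False
        then have "Suc i = length p" using that by simp
        then have "i = length p - 1" by simp
        then have "p ! i = y" using p by (simp add: last_conv_nth)
        then show ?thesis
          using step.hyps(2) \<open>Suc i = length p\<close> by (simp add: nth_append)
      qed
      then show ?thesis
        using p False by (intro exI[of _ "p @ [z]"]) auto
    qed
  qed
  then show ?thesis using that by blast
qed

text \<open>Replaces vertex lists by a bridge condition: no cycle means that deleting any edge
  separates its ends. All later arguments use only reachability.\<close>

lemma edge_cycle_iff:
  assumes "\<And>e. e \<in> F \<Longrightarrow> card e = 2"
  shows "(\<exists>p. edge_cycle F p) \<longleftrightarrow> (\<exists>a b. {a, b} \<in> F \<and> (a, b) \<in> linked (F - {{a, b}}))"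
proof
  assume "\<exists>p. edge_cycle F p"
  then obtain p where p: "3 \<le> length p" "distinct p"
      and pF: "\<And>i. i < length p \<Longrightarrow> {p ! i, p ! (Suc i mod length p)} \<in> F"
    by (auto simp: edge_cycle_def)
  \<comment> \<open>The edge closing the cycle, from \<open>p ! m\<close> back to
    \<open>p ! 0\<close>, is the one that gets deleted; the rest of the cycle still joins its
    ends.\<close>
  define m where "m = length p - 1"
  have len: "length p = Suc m" and m2: "2 \<le> m"
    using p(1) by (auto simp: m_def)
  have nth: "p ! i = p ! j \<longleftrightarrow> i = j" if "i \<le> m" "j \<le> m" for i j
    using that p(2) len by (simp add: nth_eq_iff_index_eq)
  have "(p ! 0, p ! i) \<in> linked (F - {{p ! 0, p ! m}})" if "i \<le> m" for i
    using that
  proof (induction i)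
    case (Suc i)
    have "{p ! i, p ! Suc i} \<in> F"
      using pF[of i] Suc.prems len by simp
    moreover have "{p ! i, p ! Suc i} \<noteq> {p ! 0, p ! m}"
      using Suc.prems m2 by (auto simp: doubleton_eq_iff nth)
    ultimately have "(p ! i, p ! Suc i) \<in> linked (F - {{p ! 0, p ! m}})"
      by (auto intro: linked_edge)
    then show ?case
      using Suc by (meson Suc_leD linked_trans)
  qed simp
  moreover have "{p ! 0, p ! m} \<in> F"
    using pF[of m] len by (simp add: insert_commute)
  ultimately show "\<exists>a b. {a, b} \<in> F \<and> (a, b) \<in> linked (F - {{a, b}})"
    by blast
next
  assume "\<exists>a b. {a, b} \<in> F \<and> (a, b) \<in> linked (F - {{a, b}})"
  then obtain a b where ab: "{a, b} \<in> F" "(a, b) \<in> linked (F - {{a, b}})" by blast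
  have "a \<noteq> b" using assms[OF ab(1)] by auto
  obtain p where p: "p \<noteq> []" "hd p = a" "last p = b" "distinct p"
    and pF: "\<And>i. Suc i < length p \<Longrightarrow> {p ! i, p ! Suc i} \<in> F - {{a, b}}"
    using ab(2) by (rule linked_path) blast
  have a: "p ! 0 = a" and b: "p ! (length p - 1) = b"
    using p by (auto simp: hd_conv_nth last_conv_nth)
  \<comment> \<open>One vertex would give \<open>a = b\<close>, and two vertices would use the
    deleted edge itself, so the path has the three vertices that a cycle needs.\<close>
  have "length p \<noteq> 1" using a b \<open>a \<noteq> b\<close> by auto
  moreover have "length p \<noteq> 2" using a b pF[of 0] by auto
  moreover have "length p \<noteq> 0" using p(1) by simp
  ultimately have len: "3 \<le> length p" by linarith
  have "{p ! i, p ! (Suc i mod length p)} \<in> F" if "i < length p" for i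
  proof (cases "Suc i < length p")
    case True
    then show ?thesis using pF[of i] by simp
  next
    case False
    then have "Suc i = length p" using that by simp
    then show ?thesis
      using a b ab(1) by (metis diff_Suc_1 insert_commute mod_self)
  qed
  then show "\<exists>p. edge_cycle F p"
    using len p(4) by (auto simp: edge_cycle_def)
qed

section \<open>Spanning trees of the complete graph: edge exchange and minimality\<close>

lemma finite_complete_edges [simp]: "finite (complete_edges n)"
  by (rule finite_subset[of _ "Pow {..<n}"]) (auto simp: complete_edges_def)

lemma complete_edgesE:
  assumes "e \<in> complete_edges n"
  obtains a b where "e = {a, b}" "a < n" "b < n" "a \<noteq> b"
  using assms by (auto simp: complete_edges_def card_2_iff)

lemma pair_in_complete_edges: "{a, b} \<in> complete_edges n \<longleftrightarrow> a < n \<and> b < n \<and> a \<noteq> b"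
  by (auto simp: complete_edges_def card_2_iff doubleton_eq_iff)

lemma is_spanning_tree_iff:
  "is_spanning_tree n F \<longleftrightarrow> F \<subseteq> complete_edges n \<and> edges_connect {..<n} F \<and>
     (\<forall>a b. {a, b} \<in> F \<longrightarrow> (a, b) \<notin> linked (F - {{a, b}}))"
proof (cases "F \<subseteq> complete_edges n")
  case True
  then have "\<And>e. e \<in> F \<Longrightarrow> card e = 2" by (auto simp: complete_edges_def)
  from edge_cycle_iff[OF this] show ?thesis
    by (auto simp: is_spanning_tree_def)
qed (simp add: is_spanning_tree_def)

text \<open>Deleting \<open>{u, v}\<close> splits the tree into two sides; an edge between the sides
  reconnects them and creates no cycle.\<close>

lemma is_spanning_tree_swap:
  assumes F: "is_spanning_tree n F" and e: "{u, v} \<in> F"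
    and g: "{a, b} \<in> complete_edges n" "(a, b) \<notin> linked (F - {{u, v}})"
  shows "is_spanning_tree n (insert {a, b} (F - {{u, v}}))"
proof -
  define H where "H = F - {{u, v}}"
  have FH: "F = insert {u, v} H" using e by (auto simp: H_def)
  have sub: "F \<subseteq> complete_edges n" and con: "edges_connect {..<n} F"
    and bridge: "\<And>x y. {x, y} \<in> F \<Longrightarrow> (x, y) \<notin> linked (F - {{x, y}})"
    using F by (auto simp: is_spanning_tree_iff)
  have "a < n" "b < n" using g by (auto simp: pair_in_complete_edges)
  then have "(a, b) \<in> linked (insert {u, v} H)"
    using con unfolding FH by (simp add: edges_connect_iff)
  moreover have "(a, b) \<notin> linked H" using g by (simp add: H_def)
  ultimately have ab: "(a, u) \<in> linked H \<and> (v, b) \<in> linked H \<or>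
      (a, v) \<in> linked H \<and> (u, b) \<in> linked H"
    by (simp add: linked_insert)
  let ?G = "insert {a, b} H"
  have uv: "(u, v) \<in> linked ?G"
    using ab by (auto simp: linked_insert intro: linked_sym)
  have "linked F \<subseteq> linked ?G"
    unfolding FH
    by (rule linked_subset) (use uv in \<open>auto simp: doubleton_eq_iff intro: linked_edge linked_sym\<close>)
  then have "edges_connect {..<n} ?G"
    using con by (auto simp: edges_connect_iff)
  moreover have "(x, y) \<notin> linked (?G - {{x, y}})" if xy: "{x, y} \<in> ?G" for x y
  proof (cases "{x, y} = {a, b}")
    case True
    have "(x, y) \<notin> linked H"
      using True g by (auto simp: H_def doubleton_eq_iff dest: linked_sym)
    moreover have "linked (?G - {{x, y}}) \<subseteq> linked H"
      using True by (intro linked_mono) auto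
    ultimately show ?thesis by blast
  next
    case False
    then have xyH: "{x, y} \<in> H" using xy by simp
    then have ne: "{x, y} \<noteq> {u, v}" by (auto simp: H_def)
    \<comment> \<open>If \<open>{x, y}\<close> were no longer a bridge, the new edge would have to
      join its two sides in \<open>J\<close>; then \<open>a\<close> and \<open>b\<close> would be
      linked in \<open>H\<close> through \<open>{x, y}\<close>.\<close>
    define J where "J = H - {{x, y}}"
    have HJ: "H = insert {x, y} J" using xyH by (auto simp: J_def)
    have nxy: "(x, y) \<notin> linked (insert {u, v} J)"
    proof -
      have "insert {u, v} J = F - {{x, y}}" using ne by (auto simp: FH J_def)
      then show ?thesis using bridge[of x y] xyH by (simp add: FH)
    qed
    then have nJ: "(x, y) \<notin> linked J" by (simp add: linked_insert)
    show ?thesis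
    proof
      assume "(x, y) \<in> linked (?G - {{x, y}})"
      moreover have "?G - {{x, y}} = insert {a, b} J"
        using False by (auto simp: J_def)
      ultimately have "(x, a) \<in> linked J \<and> (b, y) \<in> linked J \<or> (x, b) \<in> linked J \<and> (a, y) \<in> linked J"
        using nJ by (simp add: linked_insert)
      moreover have "linked J \<subseteq> linked H"
        by (intro linked_mono) (auto simp: J_def)
      ultimately have "(x, a) \<in> linked H \<and> (b, y) \<in> linked H \<or> (x, b) \<in> linked H \<and> (a, y) \<in> linked H"
        by blast
      then have "(a, b) \<in> linked H"
        using linked_edge[OF xyH] by (elim disjE conjE) (metis linked_sym linked_trans)+
      then show False using g by (simp add: H_def)
    qed
  qed
  ultimately show ?thesis
    using sub g(1) unfolding is_spanning_tree_iff H_def by blast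
qed

text \<open>By exchange in both directions, an edge is in the minimum tree exactly when strictly
  lighter edges do not join its ends. The right-hand side does not mention \<open>F\<close>, so this
  gives uniqueness as well as the link to Kruskal's algorithm.\<close>

lemma min_spanning_tree_eq:
  assumes F: "is_min_spanning_tree n w F" and inj: "inj_on w (complete_edges n)"
  shows "F = {e \<in> complete_edges n. \<not> edges_connect e {g \<in> complete_edges n. w g < w e}}"
proof -
  have st: "is_spanning_tree n F" and min: "\<And>G. is_spanning_tree n G \<Longrightarrow> sum w F \<le> sum w G"
    using F by (auto simp: is_min_spanning_tree_def)
  have sub: "F \<subseteq> complete_edges n" and con: "edges_connect {..<n} F"
    and bridge: "\<And>x y. {x, y} \<in> F \<Longrightarrow> (x, y) \<notin> linked (F - {{x, y}})"
    using st by (auto simp: is_spanning_tree_iff)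
  have fin: "finite F" using sub finite_complete_edges by (rule finite_subset)
  have swap: "w {u, v} \<le> w {a, b}"
    if uv: "{u, v} \<in> F" and ab: "{a, b} \<in> complete_edges n" "(a, b) \<notin> linked (F - {{u, v}})" for u v a b
  proof -
    have "{a, b} \<notin> F - {{u, v}}" using ab(2) linked_edge by metis
    then have "sum w (insert {a, b} (F - {{u, v}})) = w {a, b} + (sum w F - w {u, v})"
      using fin uv by (simp add: sum_diff1)
    then show ?thesis
      using min[OF is_spanning_tree_swap[OF st uv ab]] by simp
  qed
  show ?thesis
  proof (intro equalityI subsetI)
    fix e assume e: "e \<in> F"
    then have eE: "e \<in> complete_edges n" using sub by auto
    then obtain u v where uv: "e = {u, v}" by (rule complete_edgesE)
    let ?A = "{g \<in> complete_edges n. w g < w e}"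
    have "\<not> edges_connect e ?A"
    proof
      assume "edges_connect e ?A"
      then have "(u, v) \<in> linked ?A" unfolding uv edges_connect_pair by simp
      moreover have "linked ?A \<subseteq> linked (F - {e})"
      proof (rule linked_subset)
        \<comment> \<open>A lighter edge crossing the cut left by \<open>e\<close> could replace
          \<open>e\<close> and lower the weight, so every lighter edge stays within one
          side.\<close>
        fix a b assume "{a, b} \<in> ?A"
        then show "(a, b) \<in> linked (F - {e})"
          using swap[of u v a b] e by (cases "(a, b) \<in> linked (F - {e})") (auto simp: uv)
      qed
      ultimately show False using bridge e uv by blast
    qed
    then show "e \<in> {e \<in> complete_edges n. \<not> edges_connect e {g \<in> complete_edges n. w g < w e}}"
      using eE by simp
  next
    fix e assume "e \<in> {e \<in> complete_edges n. \<not> edges_connect e {g \<in> complete_edges n. w g < w e}}"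
    then have eE: "e \<in> complete_edges n" and ne: "\<not> edges_connect e {g \<in> complete_edges n. w g < w e}"
      by auto
    obtain u v where uv: "e = {u, v}" "u < n" "v < n" using eE by (rule complete_edgesE)
    show "e \<in> F"
    proof (rule ccontr)
      assume nF: "e \<notin> F"
      have "(u, v) \<in> linked F" using con uv by (simp add: edges_connect_iff)
      \<comment> \<open>A smallest connecting subset plays the role of the tree path from
        \<open>u\<close> to \<open>v\<close>: each of its edges separates \<open>u\<close> from
        \<open>v\<close> when deleted. One of them is heavier than \<open>e\<close>, and exchanging
        it for \<open>e\<close> contradicts minimality.\<close>
      then obtain P where P: "P \<subseteq> F" "(u, v) \<in> linked P"
        and least: "\<And>P'. P' \<subseteq> F \<Longrightarrow> (u, v) \<in> linked P' \<Longrightarrow> card P \<le> card P'"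
        using ex_has_least_nat[of "\<lambda>P. P \<subseteq> F \<and> (u, v) \<in> linked P" F card] by auto
      have "\<not> P \<subseteq> {g \<in> complete_edges n. w g < w e}"
        using ne P(2) linked_mono unfolding uv edges_connect_pair by blast
      then obtain g where g: "g \<in> P" "\<not> w g < w e" using P(1) sub by blast
      have gF: "g \<in> F" and gE: "g \<in> complete_edges n" using g P sub by auto
      have "w g \<noteq> w e" using inj gE eE gF nF by (metis inj_on_def)
      then have gt: "w e < w g" using g(2) by simp
      obtain a b where ab: "g = {a, b}" using gE by (rule complete_edgesE)
      have "card (P - {g}) < card P"
        using g(1) P(1) fin by (meson card_Diff1_less finite_subset)
      then have nP: "(u, v) \<notin> linked (P - {g})"
        using least[of "P - {g}"] P(1) by auto
      have "P = insert {a, b} (P - {g})" using g ab by auto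
      then have "(u, v) \<in> linked (insert {a, b} (P - {g}))" using P(2) by simp
      then have "(u, a) \<in> linked (P - {g}) \<and> (b, v) \<in> linked (P - {g}) \<or>
          (u, b) \<in> linked (P - {g}) \<and> (a, v) \<in> linked (P - {g})"
        using nP by (simp add: linked_insert)
      moreover have "linked (P - {g}) \<subseteq> linked (F - {g})"
        using P(1) by (intro linked_mono) auto
      ultimately have "(u, a) \<in> linked (F - {g}) \<and> (b, v) \<in> linked (F - {g}) \<or>
          (u, b) \<in> linked (F - {g}) \<and> (a, v) \<in> linked (F - {g})"
        by blast
      moreover have "(a, b) \<notin> linked (F - {g})" using bridge gF ab by blast
      ultimately have "(u, v) \<notin> linked (F - {g})"
        by (elim disjE conjE) (metis linked_sym linked_trans)+
      then have "w g \<le> w e" using swap[of a b u v] gF eE unfolding ab uv by simp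
      then show False using gt by simp
    qed
  qed
qed

text \<open>Kruskal's algorithm with the order given as a list. Using the edge \<open>e\<close>
  itself as the vertex set in \<open>edges_connect\<close> tests whether its ends are already
  joined.\<close>

definition greedy :: "'a set set \<Rightarrow> 'a set list \<Rightarrow> 'a set set" where
  "greedy = foldl (\<lambda>F e. if edges_connect e F then F else insert e F)"

lemma greedy_Nil [simp]: "greedy F [] = F"
  by (simp add: greedy_def)

lemma greedy_Cons: "greedy F (e # es) = greedy (if edges_connect e F then F else insert e F) es"
  by (simp add: greedy_def)

lemma greedy_snoc: "greedy F (es @ [e]) =
    (if edges_connect e (greedy F es) then greedy F es else insert e (greedy F es))"
  by (simp add: greedy_def)

text \<open>A rejected edge joins vertices that are linked already, so the selected edges have the
  same connectivity as all edges read so far.\<close>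

lemma linked_greedy:
  assumes "set es \<subseteq> complete_edges n"
  shows "linked (greedy F es) = linked (F \<union> set es)"
  using assms
proof (induction es rule: rev_induct)
  case (snoc e es)
  then have IH: "linked (greedy F es) = linked (F \<union> set es)" by simp
  have "e \<in> complete_edges n" using snoc.prems by simp
  then obtain a b where ab: "e = {a, b}" by (rule complete_edgesE)
  show ?case
  proof (cases "(a, b) \<in> linked (F \<union> set es)")
    case True
    then have "greedy F (es @ [e]) = greedy F es"
      by (simp add: greedy_snoc ab edges_connect_pair IH)
    then show ?thesis using linked_insert_self[OF True] IH ab by simp
  next
    case False
    then have "greedy F (es @ [e]) = insert {a, b} (greedy F es)"
      by (simp add: greedy_snoc ab edges_connect_pair IH)
    then show ?thesis
      using linked_insert[of _ _ a b] IH ab by auto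
  qed
qed simp

text \<open>In a strictly sorted list the edges read before \<open>e\<close> are exactly the lighter
  ones, so Kruskal's test becomes the criterion of \<open>min_spanning_tree_eq\<close>.\<close>

lemma greedy_sorted:
  assumes "sorted_wrt (\<lambda>e g. w e < (w g :: real)) es" "set es \<subseteq> complete_edges n"
  shows "greedy {} es = {e \<in> set es. \<not> edges_connect e {g \<in> set es. w g < w e}}"
  using assms
proof (induction es rule: rev_induct)
  case (snoc e es)
  then have IH: "greedy {} es = {e \<in> set es. \<not> edges_connect e {g \<in> set es. w g < w e}}"
    and lt: "\<And>g. g \<in> set es \<Longrightarrow> w g < w e"
    by (auto simp: sorted_wrt_append)
  have "edges_connect e (greedy {} es) \<longleftrightarrow> edges_connect e (set es)"
    using linked_greedy[of es n "{}"] snoc.prems(2) by (simp add: edges_connect_iff)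
  moreover have "{g \<in> set (es @ [e]). w g < w e} = set es"
    using lt by auto
  moreover have "{g \<in> set (es @ [e]). w g < w e'} = {g \<in> set es. w g < w e'}"
    if "e' \<in> set es" for e'
    using lt[OF that] by auto
  ultimately show ?case
    using IH lt by (auto simp: greedy_snoc)
qed simp

section \<open>Component sizes and degrees in forests\<close>

definition component :: "nat \<Rightarrow> nat set set \<Rightarrow> nat \<Rightarrow> nat set" where
  "component n F v = {u. u < n \<and> (v, u) \<in> linked F}"

definition csize :: "nat \<Rightarrow> nat set set \<Rightarrow> nat \<Rightarrow> real" where
  "csize n F v = card (component n F v)"

definition deg :: "'a set set \<Rightarrow> 'a \<Rightarrow> real" where
  "deg F v = card {e \<in> F. v \<in> e}"

text \<open>Acyclicity is built in, since only unlinked vertices are joined. This is how Kruskal's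
  algorithm grows its edge set, and it supplies the induction for degree sums.\<close>

inductive forest :: "nat \<Rightarrow> nat set set \<Rightarrow> bool" for n where
  empty: "forest n {}"
| insert: "forest n F \<Longrightarrow> a < n \<Longrightarrow> b < n \<Longrightarrow> (a, b) \<notin> linked F \<Longrightarrow> forest n (insert {a, b} F)"

lemma finite_component [simp]: "finite (component n F v)"
  by (rule finite_subset[of _ "{..<n}"]) (auto simp: component_def)

lemma component_self: "v < n \<Longrightarrow> v \<in> component n F v"
  by (simp add: component_def)

lemma component_subset: "component n F v \<subseteq> {..<n}"
  by (auto simp: component_def)

lemma component_cong: "(u, v) \<in> linked F \<Longrightarrow> component n F u = component n F v"
  by (auto simp: component_def intro: linked_trans linked_sym)

lemma component_disjoint: "(u, v) \<notin> linked F \<Longrightarrow> component n F u \<inter> component n F v = {}"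
  by (auto simp: component_def intro: linked_trans linked_sym)

lemma csize_ge_1: "v < n \<Longrightarrow> 1 \<le> csize n F v"
  using component_self[of v n F] unfolding csize_def
  by (metis card_gt_0_iff empty_iff finite_component less_eq_Suc_le One_nat_def of_nat_1 of_nat_le_iff)

lemma csize_pos: "v < n \<Longrightarrow> 0 < csize n F v"
  using csize_ge_1[of v n F] by simp

lemma csize_add_le:
  assumes "(u, v) \<notin> linked F"
  shows "csize n F u + csize n F v \<le> n"
proof -
  have "card (component n F u) + card (component n F v) = card (component n F u \<union> component n F v)"
    using assms by (simp add: card_Un_disjoint component_disjoint)
  also have "\<dots> \<le> card {..<n}"
    by (rule card_mono) (use component_subset in auto)
  finally show ?thesis by (simp add: csize_def flip: of_nat_add)
qed

lemma component_insert:
  "component n (insert {a, b} F) v =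
     (if (v, a) \<in> linked F \<or> (v, b) \<in> linked F then component n F a \<union> component n F b
      else component n F v)"
  by (auto simp: component_def linked_insert intro: linked_trans linked_sym)

lemma csize_insert:
  assumes "(a, b) \<notin> linked F" "v < n"
  shows "csize n (insert {a, b} F) v =
     (if v \<in> component n F a \<union> component n F b then csize n F a + csize n F b else csize n F v)"
proof -
  have "v \<in> component n F a \<union> component n F b \<longleftrightarrow> (v, a) \<in> linked F \<or> (v, b) \<in> linked F"
    using assms(2) by (auto simp: component_def intro: linked_sym)
  then show ?thesis
    using assms(1) by (simp add: csize_def component_insert card_Un_disjoint component_disjoint)
qed

lemma csize_in_component: "u \<in> component n F v \<Longrightarrow> csize n F u = csize n F v"
  unfolding csize_def by (metis (no_types, lifting) component_cong component_def linked_sym mem_Collect_eq)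

text \<open>Only the two merged components change, and a component of size s contributes s times
  \<open>\<phi>\<close> at s. Both potentials obtain their size increments from this.\<close>

lemma sum_csize_insert:
  fixes \<phi> :: "real \<Rightarrow> real"
  assumes ab: "(a, b) \<notin> linked F"
  shows "(\<Sum>v<n. \<phi> (csize n (insert {a, b} F) v)) = (\<Sum>v<n. \<phi> (csize n F v)) +
     (csize n F a + csize n F b) * \<phi> (csize n F a + csize n F b) -
     csize n F a * \<phi> (csize n F a) - csize n F b * \<phi> (csize n F b)"
proof -
  let ?A = "component n F a" and ?B = "component n F b"
  have split: "(\<Sum>v<n. f v) = sum f ({..<n} - (?A \<union> ?B)) + sum f ?A + sum f ?B" for f :: "nat \<Rightarrow> real"
  proof -
    have "(\<Sum>v<n. f v) = sum f ({..<n} - (?A \<union> ?B)) + sum f (?A \<union> ?B)"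
      using component_subset by (intro sum.subset_diff) auto
    then show ?thesis
      using component_disjoint[OF ab] by (simp add: sum.union_disjoint)
  qed
  have "(\<Sum>v\<in>{..<n} - (?A \<union> ?B). \<phi> (csize n (insert {a, b} F) v)) =
      (\<Sum>v\<in>{..<n} - (?A \<union> ?B). \<phi> (csize n F v))"
    by (rule sum.cong) (auto simp: csize_insert[OF ab])
  moreover have "(\<Sum>v\<in>?A. \<phi> (csize n (insert {a, b} F) v)) = csize n F a * \<phi> (csize n F a + csize n F b)"
  proof -
    have "csize n (insert {a, b} F) v = csize n F a + csize n F b" if "v \<in> ?A" for v
      using that component_subset[of n F a] by (subst csize_insert[OF ab]) auto
    then show ?thesis by (simp add: csize_def[of n F a])
  qed
  moreover have "(\<Sum>v\<in>?B. \<phi> (csize n (insert {a, b} F) v)) = csize n F b * \<phi> (csize n F a + csize n F b)"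
  proof -
    have "csize n (insert {a, b} F) v = csize n F a + csize n F b" if "v \<in> ?B" for v
      using that component_subset[of n F b] by (subst csize_insert[OF ab]) auto
    then show ?thesis by (simp add: csize_def[of n F b])
  qed
  moreover have "(\<Sum>v\<in>component n F w. \<phi> (csize n F v)) = csize n F w * \<phi> (csize n F w)" for w
    by (subst sum.cong[OF refl, of _ _ "\<lambda>_. \<phi> (csize n F w)"])
      (simp add: csize_in_component, simp add: csize_def)
  ultimately show ?thesis
    unfolding split by (simp add: algebra_simps)
qed

text \<open>Double counting of linked pairs: each value may be replaced by its mean over the
  component without changing the total.\<close>

lemma component_average:
  fixes g :: "nat \<Rightarrow> real"
  shows "(\<Sum>u<n. g u) = (\<Sum>w<n. (\<Sum>u\<in>component n F w. g u) / csize n F w)"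
proof -
  have "(\<Sum>w<n. (\<Sum>u\<in>component n F w. g u) / csize n F w) =
      (\<Sum>w<n. \<Sum>u | u \<in> {..<n} \<and> (w, u) \<in> linked F. g u / csize n F w)"
    by (simp add: sum_divide_distrib component_def)
  also have "\<dots> = (\<Sum>u<n. \<Sum>w | w \<in> {..<n} \<and> (w, u) \<in> linked F. g u / csize n F w)"
    by (rule sum.swap_restrict) auto
  also have "\<dots> = (\<Sum>u<n. \<Sum>w\<in>component n F u. g u / csize n F u)"
    by (intro sum.cong refl) (auto simp: component_def csize_def intro: linked_sym
        dest: component_cong[of _ _ F n])
  also have "\<dots> = (\<Sum>u<n. g u)"
  proof (rule sum.cong[OF refl])
    fix u assume "u \<in> {..<n}"
    then show "(\<Sum>w\<in>component n F u. g u / csize n F u) = g u"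
      using csize_pos[of u n F] by (auto simp: csize_def)
  qed
  finally show ?thesis by simp
qed

lemma forest_subset: "forest n F \<Longrightarrow> F \<subseteq> complete_edges n"
proof (induction rule: forest.induct)
  case (insert F a b)
  then have "a \<noteq> b" by auto
  then show ?case using insert by (simp add: pair_in_complete_edges)
qed simp

lemma forest_finite: "forest n F \<Longrightarrow> finite F"
  using forest_subset finite_subset finite_complete_edges by metis

lemma deg_insert:
  assumes "finite F" "(a, b) \<notin> linked F"
  shows "deg (insert {a, b} F) v = deg F v + of_bool (v = a) + of_bool (v = b)"
proof -
  have "{a, b} \<notin> F" and "a \<noteq> b" using assms(2) linked_edge[of a b F] by auto
  show ?thesis
  proof (cases "v \<in> {a, b}")
    case True
    then have "{e \<in> insert {a, b} F. v \<in> e} = insert {a, b} {e \<in> F. v \<in> e}" by auto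
    then show ?thesis
      using True \<open>{a, b} \<notin> F\<close> \<open>a \<noteq> b\<close> assms(1) by (auto simp: deg_def)
  next
    case False
    then have "{e \<in> insert {a, b} F. v \<in> e} = {e \<in> F. v \<in> e}" by auto
    then show ?thesis using False by (auto simp: deg_def)
  qed
qed

text \<open>A tree on s vertices has s - 1 edges. When two components merge, the new edge adds 2 to
  the degree sum, as required by 2 (s - 1) + 2 (t - 1) + 2 = 2 (s + t - 1).\<close>

lemma sum_deg_component:
  assumes "forest n F" "w < n"
  shows "(\<Sum>u\<in>component n F w. deg F u) = 2 * (csize n F w - 1)"
  using assms
proof (induction arbitrary: w rule: forest.induct)
  case empty
  have "{(x, y). {x, y} \<in> ({} :: nat set set)}\<^sup>* = Id" by simp
  then have "component n {} w = {w}"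
    using empty by (auto simp: component_def linked_def)
  then show ?case by (simp add: deg_def csize_def)
next
  case (insert F a b)
  let ?A = "component n F a" and ?B = "component n F b"
  have disj: "?A \<inter> ?B = {}" using insert.hyps component_disjoint by blast
  have fin: "finite F" using insert.hyps(1) by (rule forest_finite)
  note deg = deg_insert[OF fin insert.hyps(4)]
  show ?case
  proof (cases "(w, a) \<in> linked F \<or> (w, b) \<in> linked F")
    case True
    then have "component n (insert {a, b} F) w = ?A \<union> ?B" by (simp add: component_insert)
    moreover have "(\<Sum>u\<in>?A \<union> ?B. deg (insert {a, b} F) u) =
        (\<Sum>u\<in>?A. deg F u) + (\<Sum>u\<in>?B. deg F u) + 2"
      using insert.hyps component_self[of a n F] component_self[of b n F] disj
      by (auto simp: deg sum.distrib sum.union_disjoint of_bool_def)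
    ultimately show ?thesis
      using insert.IH[of a] insert.IH[of b] insert.hyps disj by (simp add: csize_def card_Un_disjoint)
  next
    case False
    then have c: "component n (insert {a, b} F) w = component n F w" by (simp add: component_insert)
    have "a \<notin> component n F w" "b \<notin> component n F w" using False by (auto simp: component_def)
    then have "(\<Sum>u\<in>component n F w. deg (insert {a, b} F) u) = (\<Sum>u\<in>component n F w. deg F u)"
      by (intro sum.cong) (auto simp: deg)
    then show ?thesis
      using c insert.IH[of w] insert.prems by (simp add: csize_def)
  qed
qed

text \<open>The weight \<open>h\<close> is constant on components, so degrees may be replaced by
  their component mean 2 - 2/s.\<close>

lemma sum_deg_mult_csize:
  fixes h :: "real \<Rightarrow> real"
  assumes "forest n F"
  shows "(\<Sum>u<n. deg F u * h (csize n F u)) = (\<Sum>u<n. 2 * (1 - 1 / csize n F u) * h (csize n F u))"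
proof -
  have "(\<Sum>u<n. deg F u * h (csize n F u)) =
      (\<Sum>w<n. (\<Sum>u\<in>component n F w. deg F u * h (csize n F u)) / csize n F w)"
    by (rule component_average)
  also have "\<dots> = (\<Sum>w<n. (\<Sum>u\<in>component n F w. deg F u) * h (csize n F w) / csize n F w)"
    by (simp add: csize_in_component sum_distrib_right cong: sum.cong)
  also have "\<dots> = (\<Sum>u<n. 2 * (1 - 1 / csize n F u) * h (csize n F u))"
  proof (rule sum.cong[OF refl])
    fix u assume "u \<in> {..<n}"
    then show "(\<Sum>u\<in>component n F u. deg F u) * h (csize n F u) / csize n F u =
        2 * (1 - 1 / csize n F u) * h (csize n F u)"
      using csize_pos[of u n F] by (simp add: sum_deg_component[OF assms] field_simps)
  qed
  finally show ?thesis .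
qed

section \<open>The two potentials and their increments\<close>

definition adjacencies :: "nat \<Rightarrow> nat set set \<Rightarrow> real" where
  "adjacencies n F = (\<Sum>v<n. deg F v * (deg F v - 1))"

text \<open>Every function of the component sizes is written as a sum over vertices: summing
  \<open>\<phi> (csize n F v)\<close> over all \<open>v\<close> gives the sum of \<open>s * \<phi> s\<close> over the component sizes \<open>s\<close>.\<close>

definition ncomps :: "nat \<Rightarrow> nat set set \<Rightarrow> real" where
  "ncomps n F = (\<Sum>v<n. 1 / csize n F v)"

text \<open>The sum of \<open>1 / (csize n F v)\<^sup>2\<close> over vertices is the sum of 1/s over
  components. At a single component of size n, the last two terms are -4/n and +4/n and
  cancel.\<close>

definition pot_lower :: "nat \<Rightarrow> nat set set \<Rightarrow> real" where
  "pot_lower n F = adjacencies n F + 8 * (ncomps n F - 1) - 4 * (\<Sum>v<n. 1 / (csize n F v)\<^sup>2)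
     - (ncomps n F - 2) * (ncomps n F + 3) / n"

definition pot_upper :: "nat \<Rightarrow> nat set set \<Rightarrow> real" where
  "pot_upper n F = adjacencies n F + 8 * (ncomps n F - 1)
     - 4 * (ncomps n F - 1) * (ncomps n F + 2) / n"

context
  fixes n a b :: nat and F :: "nat set set"
  assumes ab: "a < n" "b < n" "(a, b) \<notin> linked F"
begin

lemma adjacencies_insert:
  assumes "finite F"
  shows "adjacencies n (insert {a, b} F) = adjacencies n F + 2 * deg F a + 2 * deg F b"
proof -
  have "a \<noteq> b" using ab by auto
  have "adjacencies n (insert {a, b} F) =
      (\<Sum>v<n. deg F v * (deg F v - 1) + (if v = a then 2 * deg F a else 0) + (if v = b then 2 * deg F b else 0))"
    unfolding adjacencies_def using \<open>a \<noteq> b\<close>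
    by (intro sum.cong refl) (auto simp: deg_insert[OF assms ab(3)] algebra_simps)
  also have "\<dots> = adjacencies n F + 2 * deg F a + 2 * deg F b"
    using ab by (simp add: adjacencies_def sum.distrib)
  finally show ?thesis .
qed

lemma ncomps_insert: "ncomps n (insert {a, b} F) = ncomps n F - 1"
  using sum_csize_insert[OF ab(3), of "\<lambda>x. 1 / x" n] csize_pos[OF ab(1), of F] csize_pos[OF ab(2), of F]
  by (simp add: ncomps_def)

text \<open>Grouped so that each degree bracket has mean zero over its component; only the last
  bracket, a function of component sizes, survives averaging. \<open>pot_upper_insert\<close>
  follows the same pattern.\<close>

lemma pot_lower_insert:
  assumes "finite F"
  shows "pot_lower n (insert {a, b} F) - pot_lower n F =
     (2 * deg F a - 4 + 4 / csize n F a) + (2 * deg F b - 4 + 4 / csize n F b)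
     + (2 * ncomps n F / n - 4 / (csize n F a + csize n F b))"
proof -
  have "(\<Sum>v<n. 1 / (csize n (insert {a, b} F) v)\<^sup>2) = (\<Sum>v<n. 1 / (csize n F v)\<^sup>2) +
      1 / (csize n F a + csize n F b) - 1 / csize n F a - 1 / csize n F b"
    using sum_csize_insert[OF ab(3), of "\<lambda>x. 1 / x\<^sup>2" n]
      csize_pos[OF ab(1), of F] csize_pos[OF ab(2), of F]
    by (simp add: power2_eq_square)
  moreover have "(ncomps n F - 2) * (ncomps n F + 3) / n - (ncomps n F - 1 - 2) * (ncomps n F - 1 + 3) / n =
      2 * ncomps n F / n"
    unfolding diff_divide_distrib[symmetric] by (simp add: algebra_simps)
  ultimately show ?thesis
    unfolding pot_lower_def adjacencies_insert[OF assms] ncomps_insert by (simp add: algebra_simps)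
qed

lemma pot_upper_insert:
  assumes "finite F"
  shows "pot_upper n (insert {a, b} F) - pot_upper n F =
     (2 * deg F a - 4 + 4 / csize n F a) + (2 * deg F b - 4 + 4 / csize n F b)
     + (8 * ncomps n F / n - 4 / csize n F a - 4 / csize n F b)"
proof -
  have "4 * (ncomps n F - 1) * (ncomps n F + 2) / n - 4 * (ncomps n F - 1 - 1) * (ncomps n F - 1 + 2) / n =
      8 * ncomps n F / n"
    unfolding diff_divide_distrib[symmetric] by (simp add: algebra_simps)
  then show ?thesis
    unfolding pot_upper_def adjacencies_insert[OF assms] ncomps_insert by (simp add: algebra_simps)
qed

end

section \<open>Averaging the increments over crossing edges\<close>

definition crossing :: "nat \<Rightarrow> nat set set \<Rightarrow> nat set set" where
  "crossing n F = {e \<in> complete_edges n. \<not> edges_connect e F}"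

text \<open>Each crossing edge comes from two ordered pairs of unlinked vertices, hence the factor
  2.\<close>

lemma sum_crossing:
  fixes g :: "nat set \<Rightarrow> real"
  shows "2 * sum g (crossing n F) = (\<Sum>u<n. \<Sum>v\<in>{..<n} - component n F u. g {u, v})"
proof -
  let ?P = "Sigma {..<n} (\<lambda>u. {..<n} - component n F u)"
  let ?f = "\<lambda>(u, v). {u, v}"
  have P: "(u, v) \<in> ?P \<longleftrightarrow> u < n \<and> v < n \<and> (u, v) \<notin> linked F" for u v
    by (auto simp: component_def)
  have "(\<Sum>u<n. \<Sum>v\<in>{..<n} - component n F u. g {u, v}) = (\<Sum>p\<in>?P. g (?f p))"
    by (subst sum.Sigma) (auto simp: case_prod_beta)
  also have "\<dots> = (\<Sum>e\<in>crossing n F. \<Sum>p | p \<in> ?P \<and> ?f p = e. g (?f p))"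
  proof (rule sum.group[symmetric])
    show "?f ` ?P \<subseteq> crossing n F"
      by (auto simp: crossing_def pair_in_complete_edges edges_connect_pair component_def)
  qed (auto simp: crossing_def)
  also have "\<dots> = (\<Sum>e\<in>crossing n F. 2 * g e)"
  proof (rule sum.cong[OF refl])
    fix e assume e: "e \<in> crossing n F"
    then obtain a b where ab: "e = {a, b}" "a < n" "b < n" "a \<noteq> b"
      by (auto simp: crossing_def elim: complete_edgesE)
    have "(a, b) \<notin> linked F" using e unfolding ab crossing_def by (auto simp: edges_connect_pair)
    then have "{p. p \<in> ?P \<and> ?f p = e} = {(a, b), (b, a)}"
      using ab P linked_sym[of b a F] by (auto simp: doubleton_eq_iff simp del: mem_Sigma_iff)
    then show "(\<Sum>p | p \<in> ?P \<and> ?f p = e. g (?f p)) = 2 * g e"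
      using ab by (simp add: insert_commute)
  qed
  finally show ?thesis by (simp add: sum_distrib_left)
qed

lemma sum_noncomponent_snd:
  fixes f :: "nat \<Rightarrow> real"
  shows "(\<Sum>u<n. \<Sum>v\<in>{..<n} - component n F u. f v) = (\<Sum>u<n. (n - csize n F u) * f u)"
proof -
  have "(\<Sum>u<n. \<Sum>v\<in>{..<n} - component n F u. f v) = (\<Sum>u<n. \<Sum>v | v \<in> {..<n} \<and> (u, v) \<notin> linked F. f v)"
    by (intro sum.cong refl) (auto simp: component_def)
  also have "\<dots> = (\<Sum>v<n. \<Sum>u | u \<in> {..<n} \<and> (u, v) \<notin> linked F. f v)"
    by (rule sum.swap_restrict) auto
  also have "\<dots> = (\<Sum>v<n. \<Sum>u\<in>{..<n} - component n F v. f v)"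
    by (intro sum.cong refl) (auto simp: component_def intro: linked_sym)
  also have "\<dots> = (\<Sum>v<n. (n - csize n F v) * f v)"
    using component_subset card_mono[OF _ component_subset]
    by (intro sum.cong refl) (auto simp: csize_def card_Diff_subset of_nat_diff)
  finally show ?thesis .
qed

lemma sum_noncomponent_fst:
  fixes f :: "nat \<Rightarrow> real"
  shows "(\<Sum>u<n. \<Sum>v\<in>{..<n} - component n F u. f u) = (\<Sum>u<n. (n - csize n F u) * f u)"
  using component_subset card_mono[OF _ component_subset]
  by (intro sum.cong refl) (auto simp: csize_def card_Diff_subset of_nat_diff)

text \<open>A vertex in a component of size s is counted with weight n - s, which is constant on the
  component, while the bracket has mean zero there.\<close>

lemma sum_noncomponent_deg:
  assumes "forest n F"
  shows "(\<Sum>u<n. \<Sum>v\<in>{..<n} - component n F u.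
     (2 * deg F u - 4 + 4 / csize n F u) + (2 * deg F v - 4 + 4 / csize n F v)) = 0"
proof -
  have "(\<Sum>u<n. (n - csize n F u) * (2 * deg F u - 4 + 4 / csize n F u)) =
      2 * (\<Sum>u<n. deg F u * (n - csize n F u)) - (\<Sum>u<n. 4 * (1 - 1 / csize n F u) * (n - csize n F u))"
    unfolding sum_distrib_left sum_subtractf[symmetric]
    by (rule sum.cong) (auto simp: algebra_simps)
  also have "\<dots> = 0"
    unfolding sum_deg_mult_csize[OF assms, of "\<lambda>x. n - x"] sum_distrib_left
    by (simp add: algebra_simps)
  finally have zero: "(\<Sum>u<n. (n - csize n F u) * (2 * deg F u - 4 + 4 / csize n F u)) = 0" .
  have "(\<Sum>u<n. \<Sum>v\<in>{..<n} - component n F u.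
      (2 * deg F u - 4 + 4 / csize n F u) + (2 * deg F v - 4 + 4 / csize n F v)) =
     (\<Sum>u<n. \<Sum>v\<in>{..<n} - component n F u. 2 * deg F u - 4 + 4 / csize n F u) +
     (\<Sum>u<n. \<Sum>v\<in>{..<n} - component n F u. 2 * deg F v - 4 + 4 / csize n F v)"
    by (simp only: sum.distrib)
  then show ?thesis
    by (simp only: zero sum_noncomponent_fst[of "\<lambda>u. 2 * deg F u - 4 + 4 / csize n F u" n F]
        sum_noncomponent_snd[of "\<lambda>u. 2 * deg F u - 4 + 4 / csize n F u" n F])
qed

text \<open>Cauchy-Schwarz with its exact remainder. The upper potential needs only the sign of the
  left side; the lower one needs its value.\<close>

lemma sum_sq_diff:
  fixes c :: "nat \<Rightarrow> real"
  assumes "\<And>u. u < n \<Longrightarrow> 0 < c u"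
  shows "(\<Sum>u<n. \<Sum>v<n. (c u - c v)\<^sup>2 / (c u * c v)) =
     2 * (\<Sum>u<n. c u) * (\<Sum>u<n. 1 / c u) - 2 * (real n)\<^sup>2"
proof -
  have "(\<Sum>u<n. \<Sum>v<n. (c u - c v)\<^sup>2 / (c u * c v)) =
      (\<Sum>u<n. \<Sum>v<n. c u * (1 / c v) + (1 / c u) * c v - 2)"
  proof (intro sum.cong refl)
    fix u v assume "u \<in> {..<n}" "v \<in> {..<n}"
    then have "c u \<noteq> 0" "c v \<noteq> 0" using assms[of u] assms[of v] by auto
    then show "(c u - c v)\<^sup>2 / (c u * c v) = c u * (1 / c v) + (1 / c u) * c v - 2"
      by (simp add: divide_simps) (simp add: power2_eq_square algebra_simps)
  qed
  also have "\<dots> = (\<Sum>u<n. c u) * (\<Sum>u<n. 1 / c u) + (\<Sum>u<n. 1 / c u) * (\<Sum>u<n. c u) - 2 * (real n)\<^sup>2"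
    unfolding sum_product sum_subtractf sum.distrib by (simp add: power2_eq_square)
  finally show ?thesis by simp
qed

lemma sum_csize_mult_ge:
  "(real n)\<^sup>2 \<le> (\<Sum>u<n. csize n F u) * ncomps n F"
proof -
  have "0 \<le> (\<Sum>u<n. \<Sum>v<n. (csize n F u - csize n F v)\<^sup>2 / (csize n F u * csize n F v))"
    using csize_pos by (intro sum_nonneg) (simp add: less_imp_le)
  then show ?thesis
    using sum_sq_diff[of n "csize n F", OF csize_pos] by (simp only: ncomps_def)
qed

lemma sum_crossing_upper:
  assumes "0 < n"
  shows "(\<Sum>u<n. \<Sum>v\<in>{..<n} - component n F u.
     8 * ncomps n F / n - 4 / csize n F u - 4 / csize n F v) \<le> 0"
proof -
  let ?Q = "\<Sum>u<n. csize n F u" and ?k = "ncomps n F"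
  have "(\<Sum>u<n. \<Sum>v\<in>{..<n} - component n F u. 8 * ?k / n - 4 / csize n F u - 4 / csize n F v) =
     (\<Sum>u<n. (n - csize n F u) * (8 * ?k / n - 8 * (1 / csize n F u)))"
  proof -
    have "(\<Sum>u<n. \<Sum>v\<in>{..<n} - component n F u. 8 * ?k / n - 4 / csize n F u - 4 / csize n F v) =
        (\<Sum>u<n. \<Sum>v\<in>{..<n} - component n F u. 8 * ?k / n - 4 / csize n F u) -
        (\<Sum>u<n. \<Sum>v\<in>{..<n} - component n F u. 4 / csize n F v)"
      by (simp only: sum_subtractf)
    also have "\<dots> = (\<Sum>u<n. (n - csize n F u) * (8 * ?k / n - 4 / csize n F u)) -
        (\<Sum>u<n. (n - csize n F u) * (4 / csize n F u))"
      by (simp only: sum_noncomponent_snd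
          sum_noncomponent_fst[of "\<lambda>u. 8 * ?k / n - 4 / csize n F u" n F])
    also have "\<dots> = (\<Sum>u<n. (n - csize n F u) * (8 * ?k / n - 8 * (1 / csize n F u)))"
      unfolding sum_subtractf[symmetric] by (rule sum.cong) (auto simp: algebra_simps)
    finally show ?thesis .
  qed
  also have "\<dots> = (\<Sum>u<n. 8 * ?k - 8 * n * (1 / csize n F u) - csize n F u * (8 * ?k / n) + 8)"
    using assms csize_pos[of _ n F] by (intro sum.cong refl) (force simp: field_simps)
  also have "\<dots> = n * (8 * ?k) - 8 * n * ?k - ?Q * (8 * ?k / n) + 8 * n"
    unfolding sum.distrib sum_subtractf sum_distrib_left[symmetric] sum_distrib_right[symmetric] ncomps_def
    by simp
  \<comment> \<open>\<open>?Q\<close> is the sum of the squared component sizes and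
    \<open>?k\<close> the number of components, so the sign is that of n^2 - Qk.\<close>
  also have "\<dots> = (8 / n) * ((real n)\<^sup>2 - ?Q * ?k)"
    using assms by (simp add: field_simps power2_eq_square)
  also have "\<dots> \<le> 0"
    using sum_csize_mult_ge[of n F] assms by (intro mult_nonneg_nonpos) auto
  finally show ?thesis .
qed

text \<open>Compare 1/(s + t) with (1/s + 1/t)/4. The deficit is a squared difference weighted by
  1/(s + t), at least 1/n for distinct components, and its sum is known from
  \<open>sum_sq_diff\<close>.\<close>

lemma sum_crossing_lower:
  assumes "0 < n"
  shows "0 \<le> (\<Sum>u<n. \<Sum>v\<in>{..<n} - component n F u.
     2 * ncomps n F / n - 4 / (csize n F u + csize n F v))"
proof -
  let ?c = "csize n F" and ?Q = "\<Sum>u<n. csize n F u" and ?k = "ncomps n F"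
  have c: "0 < ?c u" if "u < n" for u using that by (rule csize_pos)
  \<comment> \<open>For \<open>x = y\<close> the correction vanishes, so
    \<open>x + y \<le> n\<close> is required only for unequal sizes. This lets the bound be summed
    over all pairs, including those within a large component.\<close>
  have bound: "1 / (x + y) \<le> (1 / x + 1 / y) / 4 - (x - y)\<^sup>2 / (x * y) / (4 * n)"
    if xy: "0 < x" "0 < y" and le: "x \<noteq> y \<longrightarrow> x + y \<le> n" for x y :: real
  proof -
    have "(x - y)\<^sup>2 / (x * y) / (4 * n) \<le> (x - y)\<^sup>2 / (x * y) / (4 * (x + y))"
    proof (cases "x = y")
      case False
      then show ?thesis using xy le assms by (intro divide_left_mono) auto
    qed simp
    moreover have "1 / (x + y) = (1 / x + 1 / y) / 4 - (x - y)\<^sup>2 / (x * y) / (4 * (x + y))"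
      using xy by (simp add: divide_simps) (simp add: power2_eq_square algebra_simps)
    ultimately show ?thesis by linarith
  qed
  have "(\<Sum>u<n. \<Sum>v<n. 1 / (?c u + ?c v)) \<le>
      (\<Sum>u<n. \<Sum>v<n. (1 / ?c u + 1 / ?c v) / 4 - (?c u - ?c v)\<^sup>2 / (?c u * ?c v) / (4 * n))"
  proof (intro sum_mono bound impI)
    fix u v assume "?c u \<noteq> ?c v"
    then have "(u, v) \<notin> linked F" by (auto simp: csize_def dest: component_cong[of _ _ F n])
    then show "?c u + ?c v \<le> n" by (rule csize_add_le)
  qed (auto intro: c)
  also have "\<dots> = n * ?k / 2 - (2 * ?Q * ?k - 2 * (real n)\<^sup>2) / (4 * n)"
  proof -
    have "(\<Sum>u<n. \<Sum>v<n. (1 / ?c u + 1 / ?c v) / 4 - (?c u - ?c v)\<^sup>2 / (?c u * ?c v) / (4 * n)) =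
        ((\<Sum>u<n. \<Sum>v<n. 1 / ?c u) + (\<Sum>u<n. \<Sum>v<n. 1 / ?c v)) / 4
        - (\<Sum>u<n. \<Sum>v<n. (?c u - ?c v)\<^sup>2 / (?c u * ?c v)) / (4 * n)"
      by (simp only: sum_subtractf sum.distrib sum_divide_distrib[symmetric])
    moreover have "(\<Sum>u<n. \<Sum>v<n. 1 / ?c u) = n * ?k" "(\<Sum>u<n. \<Sum>v<n. 1 / ?c v) = n * ?k"
      by (simp_all add: ncomps_def sum_distrib_left)
    moreover have "(\<Sum>u<n. \<Sum>v<n. (?c u - ?c v)\<^sup>2 / (?c u * ?c v)) = 2 * ?Q * ?k - 2 * (real n)\<^sup>2"
      unfolding ncomps_def by (rule sum_sq_diff) (rule c)
    ultimately show ?thesis by simp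
  qed
  finally have all: "(\<Sum>u<n. \<Sum>v<n. 1 / (?c u + ?c v)) \<le>
      n * ?k / 2 - (2 * ?Q * ?k - 2 * (real n)\<^sup>2) / (4 * n)" .
  \<comment> \<open>Pairs inside one component contribute s * 1/(2s) for each \<open>u\<close>; they
    are subtracted again to return to the crossing pairs.\<close>
  have same: "(\<Sum>v\<in>component n F u. 1 / (?c u + ?c v)) = 1 / 2" if "u < n" for u
  proof -
    have "(\<Sum>v\<in>component n F u. 1 / (?c u + ?c v)) = (\<Sum>v\<in>component n F u. 1 / (?c u + ?c u))"
      by (intro sum.cong refl) (simp add: csize_in_component)
    also have "\<dots> = ?c u * (1 / (?c u + ?c u))"
      by (simp add: csize_def)
    finally show ?thesis using c[OF that] by simp
  qed
  have "(\<Sum>u<n. \<Sum>v<n. 1 / (?c u + ?c v)) =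
     (\<Sum>u<n. (\<Sum>v\<in>{..<n} - component n F u. 1 / (?c u + ?c v)) + 1 / 2)"
  proof (intro sum.cong refl)
    fix u assume u: "u \<in> {..<n}"
    show "(\<Sum>v<n. 1 / (?c u + ?c v)) = (\<Sum>v\<in>{..<n} - component n F u. 1 / (?c u + ?c v)) + 1 / 2"
      using sum.subset_diff[OF component_subset[of n F u], where g = "\<lambda>v. 1 / (?c u + ?c v)"] same[of u] u by simp
  qed
  then have le: "(\<Sum>u<n. \<Sum>v\<in>{..<n} - component n F u. 1 / (?c u + ?c v)) \<le>
      n * ?k / 2 - (2 * ?Q * ?k - 2 * (real n)\<^sup>2) / (4 * n) - n / 2"
    using all by (simp add: sum.distrib)
  have eq1: "(\<Sum>u<n. \<Sum>v\<in>{..<n} - component n F u. 2 * ?k / n - 4 / (?c u + ?c v)) =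
      (\<Sum>u<n. (n - ?c u) * (2 * ?k / n)) - 4 * (\<Sum>u<n. \<Sum>v\<in>{..<n} - component n F u. 1 / (?c u + ?c v))"
    unfolding sum_subtractf sum_noncomponent_fst sum_distrib_left by simp
  have eq2: "(\<Sum>u<n. (n - ?c u) * (2 * ?k / n)) = 2 * n * ?k - 2 * ?Q * ?k / n"
    unfolding sum_distrib_right[symmetric] sum_subtractf
    using assms by (simp add: field_simps)
  \<comment> \<open>The remainder n^2 from \<open>sum_sq_diff\<close> and the within-component part
    n/2 cancel exactly, so the bound matches the positive part \<open>eq2\<close> with nothing
    lost.\<close>
  have eq3: "4 * (n * ?k / 2 - (2 * ?Q * ?k - 2 * (real n)\<^sup>2) / (4 * n) - n / 2) =
      2 * n * ?k - 2 * ?Q * ?k / n"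
    using assms by (simp add: field_simps power2_eq_square)
  show ?thesis
    unfolding eq1 eq2 eq3[symmetric] diff_ge_0_iff_ge using le by (rule mult_left_mono) simp
qed

lemma crossing_pot_lower:
  assumes "forest n F" "0 < n"
  shows "0 \<le> (\<Sum>e\<in>crossing n F. pot_lower n (insert e F) - pot_lower n F)"
proof -
  have "2 * (\<Sum>e\<in>crossing n F. pot_lower n (insert e F) - pot_lower n F) =
     (\<Sum>u<n. \<Sum>v\<in>{..<n} - component n F u.
        ((2 * deg F u - 4 + 4 / csize n F u) + (2 * deg F v - 4 + 4 / csize n F v))
        + (2 * ncomps n F / n - 4 / (csize n F u + csize n F v)))"
    unfolding sum_crossing
    by (intro sum.cong refl pot_lower_insert) (auto simp: component_def forest_finite[OF assms(1)])
  also have "\<dots> = (\<Sum>u<n. \<Sum>v\<in>{..<n} - component n F u.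
      (2 * deg F u - 4 + 4 / csize n F u) + (2 * deg F v - 4 + 4 / csize n F v)) +
     (\<Sum>u<n. \<Sum>v\<in>{..<n} - component n F u. 2 * ncomps n F / n - 4 / (csize n F u + csize n F v))"
    by (simp only: sum.distrib)
  also have "\<dots> \<ge> 0"
    unfolding sum_noncomponent_deg[OF assms(1)] using sum_crossing_lower[OF assms(2), of F] by simp
  finally show ?thesis by simp
qed

lemma crossing_pot_upper:
  assumes "forest n F" "0 < n"
  shows "(\<Sum>e\<in>crossing n F. pot_upper n (insert e F) - pot_upper n F) \<le> 0"
proof -
  have "2 * (\<Sum>e\<in>crossing n F. pot_upper n (insert e F) - pot_upper n F) =
     (\<Sum>u<n. \<Sum>v\<in>{..<n} - component n F u.
        ((2 * deg F u - 4 + 4 / csize n F u) + (2 * deg F v - 4 + 4 / csize n F v))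
        + (8 * ncomps n F / n - 4 / csize n F u - 4 / csize n F v))"
    unfolding sum_crossing
    by (intro sum.cong refl pot_upper_insert) (auto simp: component_def forest_finite[OF assms(1)])
  also have "\<dots> = (\<Sum>u<n. \<Sum>v\<in>{..<n} - component n F u.
      (2 * deg F u - 4 + 4 / csize n F u) + (2 * deg F v - 4 + 4 / csize n F v)) +
     (\<Sum>u<n. \<Sum>v\<in>{..<n} - component n F u. 8 * ncomps n F / n - 4 / csize n F u - 4 / csize n F v)"
    by (simp only: sum.distrib)
  also have "\<dots> \<le> 0"
    unfolding sum_noncomponent_deg[OF assms(1)] using sum_crossing_upper[OF assms(2), of F] by simp
  finally show ?thesis by simp
qed

section \<open>Averages over edge orders\<close>

text \<open>Conditioning on the first element of a uniformly random order.\<close>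

lemma sum_permutations_of_set:
  fixes g :: "'a list \<Rightarrow> real"
  assumes "finite A" "A \<noteq> {}"
  shows "(\<Sum>xs\<in>permutations_of_set A. g xs) = (\<Sum>x\<in>A. \<Sum>xs\<in>permutations_of_set (A - {x}). g (x # xs))"
proof -
  have "(\<Sum>xs\<in>permutations_of_set A. g xs) = (\<Sum>x\<in>A. \<Sum>xs\<in>(#) x ` permutations_of_set (A - {x}). g xs)"
    unfolding permutations_of_set_nonempty[OF assms(2)]
    by (rule sum.UNION_disjoint) (use assms(1) in auto)
  also have "\<dots> = (\<Sum>x\<in>A. \<Sum>xs\<in>permutations_of_set (A - {x}). g (x # xs))"
    by (rule sum.cong) (simp_all add: sum.reindex)
  finally show ?thesis .
qed

lemma forest_step: "forest n F \<Longrightarrow> e \<in> crossing n F \<Longrightarrow> forest n (insert e F)"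
  by (auto simp: crossing_def edges_connect_pair elim!: complete_edgesE intro: forest.insert)

lemma forest_greedy:
  assumes "forest n F" "set es \<subseteq> complete_edges n"
  shows "forest n (greedy F es)"
  using assms(2) assms(1)
proof (induction es rule: rev_induct)
  case (snoc e es)
  then show ?case
    using forest_step[of n "greedy F es" e] by (simp add: greedy_snoc crossing_def)
qed simp

text \<open>Adding the edges in uniformly random order, the next accepted edge is uniformly distributed
  among the crossing ones; a functional that increases on average in each such step is a
  submartingale.\<close>

lemma sum_greedy_ge:
  fixes L :: "nat set set \<Rightarrow> real"
  assumes step: "\<And>F. forest n F \<Longrightarrow> 0 \<le> (\<Sum>e\<in>crossing n F. L (insert e F) - L F)"
    and "forest n F" "crossing n F \<subseteq> R" "R \<subseteq> complete_edges n"
  shows "fact (card R) * L F \<le> (\<Sum>es\<in>permutations_of_set R. L (greedy F es))"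
  using assms(2-4)
proof (induction "card R" arbitrary: R F)
  case 0
  then have "R = {}"
    using finite_subset[OF _ finite_complete_edges] by auto
  then show ?case by simp
next
  case (Suc c)
  have fin: "finite R" using Suc.prems finite_complete_edges finite_subset by blast
  have "R \<noteq> {}" using Suc.hyps(2) by auto
  define F' where "F' e = (if edges_connect e F then F else insert e F)" for e
  have IH: "fact c * L (F' e) \<le> (\<Sum>es\<in>permutations_of_set (R - {e}). L (greedy (F' e) es))"
    if e: "e \<in> R" for e
  proof -
    have c: "c = card (R - {e})" using e Suc.hyps(2) fin by simp
    have eE: "e \<in> complete_edges n" using e Suc.prems by auto
    then obtain a b where ab: "e = {a, b}" by (rule complete_edgesE)
    have "forest n (F' e)"
      using Suc.prems(1) forest_step[of n F e] eE by (auto simp: F'_def crossing_def)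
    \<comment> \<open>Whether accepted or rejected, an edge that has been read no longer crosses, so
      every crossing edge is still among the unread ones.\<close>
    moreover have "crossing n (F' e) \<subseteq> R - {e}"
    proof -
      have "crossing n (F' e) \<subseteq> crossing n F"
        using linked_mono[of F "insert e F"] by (auto simp: crossing_def F'_def edges_connect_iff)
      moreover have "e \<notin> crossing n (F' e)"
        by (auto simp: crossing_def F'_def ab edges_connect_pair intro: linked_edge)
      ultimately show ?thesis using Suc.prems by auto
    qed
    ultimately show ?thesis
      using Suc.hyps(1)[OF c] Suc.prems c by auto
  qed
  \<comment> \<open>Rejected edges leave \<open>F\<close> unchanged and contribute zero, so the
    drift over all unread edges is the drift over the crossing ones.\<close>
  have "(\<Sum>e\<in>R. L (F' e) - L F) = (\<Sum>e\<in>crossing n F. L (insert e F) - L F)"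
    using Suc.prems fin by (intro sum.mono_neutral_cong_right) (auto simp: F'_def crossing_def)
  then have "0 \<le> (\<Sum>e\<in>R. L (F' e) - L F)"
    using step[OF Suc.prems(1)] by simp
  then have "card R * L F \<le> (\<Sum>e\<in>R. L (F' e))"
    by (simp add: sum_subtractf)
  then have "fact c * (card R * L F) \<le> fact c * (\<Sum>e\<in>R. L (F' e))"
    by (intro mult_left_mono) auto
  also have "\<dots> \<le> (\<Sum>e\<in>R. \<Sum>es\<in>permutations_of_set (R - {e}). L (greedy (F' e) es))"
    unfolding sum_distrib_left by (intro sum_mono IH)
  also have "\<dots> = (\<Sum>es\<in>permutations_of_set R. L (greedy F es))"
    unfolding sum_permutations_of_set[OF fin \<open>R \<noteq> {}\<close>] by (simp add: greedy_Cons F'_def)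
  finally show ?case
    by (simp add: Suc.hyps(2)[symmetric] algebra_simps)
qed

context
  fixes n :: nat and es :: "nat set list"
  assumes es: "es \<in> permutations_of_set (complete_edges n)"
begin

lemma forest_greedy_permutation: "forest n (greedy {} es)"
  using forest_greedy[OF forest.empty] es by (simp add: permutations_of_setD)

text \<open>The list contains every pair of vertices, so by \<open>linked_greedy\<close> the result
  is connected.\<close>

lemma component_greedy:
  assumes "v < n"
  shows "component n (greedy {} es) v = {..<n}"
proof -
  have "(v, u) \<in> linked (greedy {} es)" if "u < n" for u
  proof (cases "u = v")
    case False
    then have "{v, u} \<in> complete_edges n"
      using assms that by (simp add: pair_in_complete_edges)
    then show ?thesis
      using linked_greedy[of es n "{}"] permutations_of_setD[OF es] by (simp add: linked_edge)
  qed simp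
  then show ?thesis by (auto simp: component_def)
qed

lemma csize_greedy: "v < n \<Longrightarrow> csize n (greedy {} es) v = n"
  by (simp add: csize_def component_greedy)

lemma pot_greedy:
  assumes "0 < n"
  shows "pot_lower n (greedy {} es) = adjacencies n (greedy {} es)"
    and "pot_upper n (greedy {} es) = adjacencies n (greedy {} es)"
proof -
  have "ncomps n (greedy {} es) = 1"
    using assms by (simp add: ncomps_def csize_greedy)
  then show "pot_lower n (greedy {} es) = adjacencies n (greedy {} es)"
    "pot_upper n (greedy {} es) = adjacencies n (greedy {} es)"
    using assms by (simp_all add: pot_lower_def pot_upper_def csize_greedy power2_eq_square)
qed

lemma sum_deg_greedy: "0 < n \<Longrightarrow> (\<Sum>v<n. deg (greedy {} es) v) = 2 * (real n - 1)"
  using sum_deg_component[OF forest_greedy_permutation, of 0] by (simp add: component_greedy csize_greedy)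

end

lemma component_empty: "v < n \<Longrightarrow> component n {} v = {v}"
  by (auto simp: component_def linked_def)

lemma pot_empty:
  assumes "0 < n"
  shows "pot_lower n {} = 3 * (real n - 1) * (real n - 2) / n"
    and "pot_upper n {} = 4 * (real n - 1) * (real n - 2) / n"
proof -
  have c: "csize n {} v = 1" if "v < n" for v
    using that by (simp add: csize_def component_empty)
  have "ncomps n {} = n" by (simp add: ncomps_def c)
  moreover have "adjacencies n {} = 0" by (simp add: adjacencies_def deg_def)
  ultimately show "pot_lower n {} = 3 * (real n - 1) * (real n - 2) / n"
    "pot_upper n {} = 4 * (real n - 1) * (real n - 2) / n"
    using assms by (simp_all add: pot_lower_def pot_upper_def c field_simps)
qed

lemma sum_adjacencies_greedy:
  assumes "0 < n"
  defines "E \<equiv> complete_edges n"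
  shows "fact (card E) * (3 * (real n - 1) * (real n - 2) / n) \<le>
      (\<Sum>es\<in>permutations_of_set E. adjacencies n (greedy {} es))"
    and "(\<Sum>es\<in>permutations_of_set E. adjacencies n (greedy {} es)) \<le>
      fact (card E) * (4 * (real n - 1) * (real n - 2) / n)"
proof -
  have cr: "crossing n {} \<subseteq> E" by (auto simp: crossing_def E_def)
  have "fact (card E) * pot_lower n {} \<le> (\<Sum>es\<in>permutations_of_set E. pot_lower n (greedy {} es))"
    by (rule sum_greedy_ge[OF crossing_pot_lower forest.empty cr]) (use assms in auto)
  also have "\<dots> = (\<Sum>es\<in>permutations_of_set E. adjacencies n (greedy {} es))"
    by (intro sum.cong refl pot_greedy) (use assms in auto)
  finally show "fact (card E) * (3 * (real n - 1) * (real n - 2) / n) \<le>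
      (\<Sum>es\<in>permutations_of_set E. adjacencies n (greedy {} es))"
    using assms(1) by (simp only: pot_empty)
  \<comment> \<open>The supermartingale is handled as the submartingale of its negative.\<close>
  have "0 \<le> (\<Sum>e\<in>crossing n F. - pot_upper n (insert e F) - - pot_upper n F)" if "forest n F" for F
    using crossing_pot_upper[OF that assms(1)] by (simp add: sum_subtractf sum_negf)
  then have "fact (card E) * - pot_upper n {} \<le> (\<Sum>es\<in>permutations_of_set E. - pot_upper n (greedy {} es))"
    by (rule sum_greedy_ge[OF _ forest.empty cr]) (auto simp: E_def)
  also have "\<dots> = (\<Sum>es\<in>permutations_of_set E. - adjacencies n (greedy {} es))"
    by (intro sum.cong refl arg_cong[of _ _ uminus] pot_greedy) (use assms in auto)
  finally have "(\<Sum>es\<in>permutations_of_set E. adjacencies n (greedy {} es)) \<le> fact (card E) * pot_upper n {}"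
    by (simp add: sum_negf)
  then show "(\<Sum>es\<in>permutations_of_set E. adjacencies n (greedy {} es)) \<le>
      fact (card E) * (4 * (real n - 1) * (real n - 2) / n)"
    using assms(1) by (simp only: pot_empty)
qed

section \<open>Counting ordered pairs of edges\<close>

lemma sum_deg:
  assumes "F \<subseteq> complete_edges n"
  shows "(\<Sum>v<n. deg F v) = 2 * card F"
proof -
  have fin: "finite F" using assms finite_complete_edges by (rule finite_subset)
  have "(\<Sum>v<n. deg F v) = (\<Sum>v<n. \<Sum>e | e \<in> F \<and> v \<in> e. 1)"
    by (simp add: deg_def)
  also have "\<dots> = (\<Sum>e\<in>F. \<Sum>v | v \<in> {..<n} \<and> v \<in> e. 1)"
    using sum.swap_restrict[of "{..<n}" F "\<lambda>_ _. 1 :: real" "\<lambda>v e. v \<in> e"] fin by simp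
  also have "\<dots> = (\<Sum>e\<in>F. 2)"
  proof (intro sum.cong refl)
    fix e assume "e \<in> F"
    then have "e \<subseteq> {..<n}" "card e = 2" using assms by (auto simp: complete_edges_def)
    moreover from this have "{v. v \<in> {..<n} \<and> v \<in> e} = e" by auto
    ultimately show "(\<Sum>v | v \<in> {..<n} \<and> v \<in> e. 1) = (2 :: real)" by simp
  qed
  finally show ?thesis by simp
qed

definition adjacent_pairs :: "'a set set \<Rightarrow> ('a set \<times> 'a set) set" where
  "adjacent_pairs F = {(e, f). e \<in> F \<and> f \<in> F \<and> e \<noteq> f \<and> e \<inter> f \<noteq> {}}"

definition disjoint_pairs :: "'a set set \<Rightarrow> ('a set \<times> 'a set) set" where
  "disjoint_pairs F = {(e, f). e \<in> F \<and> f \<in> F \<and> e \<noteq> f \<and> e \<inter> f = {}}"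

lemma finite_adjacent_pairs [simp]: "finite F \<Longrightarrow> finite (adjacent_pairs F)"
  by (rule finite_subset[of _ "F \<times> F"]) (auto simp: adjacent_pairs_def)

lemma finite_disjoint_pairs [simp]: "finite F \<Longrightarrow> finite (disjoint_pairs F)"
  by (rule finite_subset[of _ "F \<times> F"]) (auto simp: disjoint_pairs_def)

lemma card_off_diagonal:
  assumes "finite A"
  shows "real (card (A \<times> A - Id_on A)) = real (card A) * (real (card A) - 1)"
proof -
  have "Id_on A = (\<lambda>x. (x, x)) ` A" by auto
  then have c: "card (Id_on A) = card A" by (simp add: card_image inj_on_def)
  have "card A \<le> card A * card A" by (cases "card A") auto
  moreover have "card (A \<times> A - Id_on A) = card A * card A - card A"
    using assms by (subst card_Diff_subset) (auto simp: c card_cartesian_product intro: finite_subset[of _ "A \<times> A"])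
  ultimately show ?thesis by (simp add: of_nat_diff algebra_simps)
qed

text \<open>Sorting the pairs by their common vertex is unambiguous: two distinct edges share at
  most one vertex. At each vertex there are d (d - 1) ordered pairs.\<close>

lemma card_adjacent_pairs:
  assumes "F \<subseteq> complete_edges n"
  shows "real (card (adjacent_pairs F)) = adjacencies n F"
proof -
  have fin: "finite F" using assms finite_complete_edges by (rule finite_subset)
  let ?D = "\<lambda>v. {e \<in> F. v \<in> e}"
  have "adjacent_pairs F = (\<Union>v\<in>{..<n}. ?D v \<times> ?D v - Id_on (?D v))"
    using assms by (auto simp: adjacent_pairs_def complete_edges_def)
  moreover have "card (\<Union>v\<in>{..<n}. ?D v \<times> ?D v - Id_on (?D v)) = (\<Sum>v<n. card (?D v \<times> ?D v - Id_on (?D v)))"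
  proof (rule card_UN_disjoint)
    show "\<forall>v\<in>{..<n}. \<forall>w\<in>{..<n}. v \<noteq> w \<longrightarrow>
        (?D v \<times> ?D v - Id_on (?D v)) \<inter> (?D w \<times> ?D w - Id_on (?D w)) = {}"
    proof (intro ballI impI equals0I)
      fix v w p assume vw: "v \<noteq> w"
        and p: "p \<in> (?D v \<times> ?D v - Id_on (?D v)) \<inter> (?D w \<times> ?D w - Id_on (?D w))"
      obtain e f where ef: "p = (e, f)" by force
      have "e \<in> F" "f \<in> F" "v \<in> e" "v \<in> f" "w \<in> e" "w \<in> f" "e \<noteq> f"
        using p unfolding ef by auto
      moreover have "g = {v, w}" if "g \<in> F" "v \<in> g" "w \<in> g" for g
        using that assms vw by (auto simp: complete_edges_def card_2_iff)
      ultimately show False by metis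
    qed
  qed (use fin in auto)
  ultimately show ?thesis
    using fin by (simp add: card_off_diagonal adjacencies_def deg_def)
qed

lemma card_disjoint_pairs:
  assumes "F \<subseteq> complete_edges n"
  shows "real (card (disjoint_pairs F)) = real (card F) * (real (card F) - 1) - adjacencies n F"
proof -
  have fin: "finite F" using assms finite_complete_edges by (rule finite_subset)
  have "F \<times> F - Id_on F = adjacent_pairs F \<union> disjoint_pairs F"
    by (auto simp: adjacent_pairs_def disjoint_pairs_def)
  moreover have "adjacent_pairs F \<inter> disjoint_pairs F = {}"
    by (auto simp: adjacent_pairs_def disjoint_pairs_def)
  ultimately have "card (F \<times> F - Id_on F) = card (adjacent_pairs F) + card (disjoint_pairs F)"
    using fin by (simp add: card_Un_disjoint)
  then show ?thesis
    using card_off_diagonal[OF fin] card_adjacent_pairs[OF assms] by simp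
qed

lemma deg_complete_edges:
  assumes "v < n"
  shows "deg (complete_edges n) v = real n - 1"
proof -
  have "{e \<in> complete_edges n. v \<in> e} = (\<lambda>u. {v, u}) ` ({..<n} - {v})"
    using assms by (auto simp: complete_edges_def card_2_iff)
  moreover have "inj_on (\<lambda>u. {v, u}) ({..<n} - {v})"
    by (auto simp: inj_on_def doubleton_eq_iff)
  ultimately show ?thesis using assms by (simp add: deg_def card_image of_nat_diff)
qed

lemma adjacencies_complete_edges:
  "adjacencies n (complete_edges n) = n * (real n - 1) * (real n - 2)"
  by (simp add: adjacencies_def deg_complete_edges)

lemma card_complete_edges: "real (card (complete_edges n)) = n * (real n - 1) / 2"
  using sum_deg[of "complete_edges n" n] by (simp add: deg_complete_edges)

text \<open>The symmetric group acts transitively on tuples of distinct elements. It is applied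
  twice: to vertices, for the symmetry of edge pairs, and to the index set, for the exchangeability
  of the weights.\<close>

lemma ex_permutes_map:
  assumes "distinct xs" "distinct ys" "length xs = length ys" "set xs \<subseteq> A" "set ys \<subseteq> A"
  shows "\<exists>p. p permutes A \<and> map p xs = ys"
  using assms(3,1,2,4,5)
proof (induction xs ys rule: rev_induct2)
  case 1
  then show ?case by (auto intro: permutes_id)
next
  case (4 x xs y ys)
  then obtain p where p: "p permutes A" "map p xs = ys" by auto
  have "p x \<in> A" "y \<in> A" using 4 permutes_in_image[OF p(1)] by auto
  \<comment> \<open>The transposition corrects the last entry and leaves \<open>ys\<close> alone,
    because neither \<open>p x\<close> nor \<open>y\<close> occurs there.\<close>
  then have "Transposition.transpose (p x) y \<circ> p permutes A"
    using p(1) permutes_swap_id permutes_compose by metis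
  moreover have "p x \<notin> set ys" "y \<notin> set ys"
    using 4 p permutes_inj[OF p(1)] by (auto simp: inj_eq)
  then have "map (Transposition.transpose (p x) y) ys = ys"
    by (intro map_idI) (metis transpose_apply_other)
  then have "map (Transposition.transpose (p x) y \<circ> p) (xs @ [x]) = ys @ [y]"
    by (simp flip: p(2) map_map)
  ultimately show ?case by blast
qed auto


section \<open>Vertex symmetry and the counts of edges and edge pairs\<close>

lemma linked_image:
  fixes \<sigma> :: "'a \<Rightarrow> 'a"
  assumes "bij \<sigma>"
  shows "(\<sigma> x, \<sigma> y) \<in> linked ((`) \<sigma> ` F) \<longleftrightarrow> (x, y) \<in> linked F"
proof -
  have imp: "(\<tau> x, \<tau> y) \<in> linked ((`) \<tau> ` F)" if "(x, y) \<in> linked F" for \<tau> :: "'a \<Rightarrow> 'a" and x y F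
    using that unfolding linked_def[of F]
  proof (induction rule: rtrancl_induct)
    case (step y z)
    then have "{\<tau> y, \<tau> z} \<in> (`) \<tau> ` F"
      by (auto simp: image_iff intro!: bexI[of _ "{y, z}"])
    then show ?case using step.IH by (blast intro: linked_trans linked_edge)
  qed simp
  have inv: "inv \<sigma> (\<sigma> x) = x" for x using assms by (simp add: bij_is_inj)
  have "(`) (inv \<sigma>) ` (`) \<sigma> ` F = F"
    by (simp add: image_image inv)
  then show ?thesis
    using imp[of "\<sigma> x" "\<sigma> y" "(`) \<sigma> ` F" "inv \<sigma>"] imp[of x y F \<sigma>] by (auto simp: inv)
qed

lemma greedy_image:
  fixes \<sigma> :: "'a \<Rightarrow> 'a"
  assumes "bij \<sigma>"
  shows "greedy {} (map ((`) \<sigma>) es) = (`) \<sigma> ` greedy {} es"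
proof (induction es rule: rev_induct)
  case (snoc e es)
  then show ?case
    by (auto simp: greedy_snoc edges_connect_iff linked_image[OF assms])
qed simp

definition edge_count :: "nat \<Rightarrow> nat set \<Rightarrow> real" where
  "edge_count n e = card {es \<in> permutations_of_set (complete_edges n). e \<in> greedy {} es}"

definition pair_count :: "nat \<Rightarrow> nat set \<Rightarrow> nat set \<Rightarrow> real" where
  "pair_count n e f =
     card {es \<in> permutations_of_set (complete_edges n). e \<in> greedy {} es \<and> f \<in> greedy {} es}"

lemma pair_count_self: "pair_count n e e = edge_count n e"
  by (simp add: pair_count_def edge_count_def)

text \<open>Relabelling vertices permutes the edge orders and commutes with \<open>greedy\<close>,
  so it is a bijection between the two sets of orders being counted.\<close>

lemma pair_count_image:
  assumes "\<sigma> permutes {..<n}"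
  shows "pair_count n (\<sigma> ` e) (\<sigma> ` f) = pair_count n e f"
proof -
  let ?P = "permutations_of_set (complete_edges n)"
  have bij: "bij \<sigma>" using assms by (rule permutes_bij)
  have inj: "inj ((`) \<sigma>)" by (rule injI) (simp add: inj_image_eq_iff bij_is_inj[OF bij])
  have "(`) \<sigma> ` complete_edges n \<subseteq> complete_edges n"
    using permutes_in_image[OF assms] permutes_inj_on[OF assms]
    by (auto simp: complete_edges_def card_image subset_eq)
  then have "(`) \<sigma> ` complete_edges n = complete_edges n"
    using inj by (intro card_subset_eq) (auto simp: card_image inj_on_subset)
  then have P: "?P = map ((`) \<sigma>) ` ?P"
    using permutations_of_set_image_inj[of "(`) \<sigma>" "complete_edges n"] inj_on_subset[OF inj subset_UNIV]
    by simp
  have mem: "\<sigma> ` e \<in> (`) \<sigma> ` G \<longleftrightarrow> e \<in> G" for e G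
    using inj by (auto simp: inj_image_mem_iff)
  have "{es \<in> ?P. \<sigma> ` e \<in> greedy {} es \<and> \<sigma> ` f \<in> greedy {} es} =
      map ((`) \<sigma>) ` {es \<in> ?P. e \<in> greedy {} es \<and> f \<in> greedy {} es}"
    by (subst P) (auto simp: greedy_image[OF bij] mem)
  moreover have "inj (map ((`) \<sigma>))" using inj by simp
  ultimately show ?thesis
    unfolding pair_count_def by (simp only: card_image[OF inj_on_subset[OF _ subset_UNIV]])
qed

lemma sum_pair_count:
  assumes "finite A"
  shows "(\<Sum>(e, f)\<in>A. pair_count n e f) =
     (\<Sum>es\<in>permutations_of_set (complete_edges n).
        real (card {(e, f) \<in> A. e \<in> greedy {} es \<and> f \<in> greedy {} es}))"
proof -
  let ?P = "permutations_of_set (complete_edges n)"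
  have "(\<Sum>(e, f)\<in>A. pair_count n e f) =
      (\<Sum>p\<in>A. \<Sum>es | es \<in> ?P \<and> fst p \<in> greedy {} es \<and> snd p \<in> greedy {} es. 1)"
    by (simp add: pair_count_def case_prod_beta)
  also have "\<dots> = (\<Sum>es\<in>?P. \<Sum>p | p \<in> A \<and> fst p \<in> greedy {} es \<and> snd p \<in> greedy {} es. 1)"
    by (rule sum.swap_restrict) (use assms in auto)
  also have "\<dots> = (\<Sum>es\<in>?P. real (card {(e, f) \<in> A. e \<in> greedy {} es \<and> f \<in> greedy {} es}))"
  proof (rule sum.cong[OF refl])
    fix es
    have "{p. p \<in> A \<and> fst p \<in> greedy {} es \<and> snd p \<in> greedy {} es} =
        {(e, f) \<in> A. e \<in> greedy {} es \<and> f \<in> greedy {} es}" by auto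
    then show "(\<Sum>p | p \<in> A \<and> fst p \<in> greedy {} es \<and> snd p \<in> greedy {} es. 1) =
        real (card {(e, f) \<in> A. e \<in> greedy {} es \<and> f \<in> greedy {} es})" by simp
  qed
  finally show ?thesis .
qed

lemma card_greedy:
  assumes "es \<in> permutations_of_set (complete_edges n)" "0 < n"
  shows "real (card (greedy {} es)) = real n - 1"
  using sum_deg_greedy[OF assms] sum_deg[OF forest_subset[OF forest_greedy_permutation[OF assms(1)]]]
  by simp

lemma sum_edge_count:
  assumes "0 < n"
  defines "E \<equiv> complete_edges n"
  shows "(\<Sum>e\<in>E. edge_count n e) = fact (card E) * (real n - 1)"
proof -
  have "(\<Sum>e\<in>E. edge_count n e) =
      (\<Sum>e\<in>E. \<Sum>es | es \<in> permutations_of_set E \<and> e \<in> greedy {} es. 1)"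
    by (simp add: edge_count_def E_def)
  also have "\<dots> = (\<Sum>es\<in>permutations_of_set E. \<Sum>e | e \<in> E \<and> e \<in> greedy {} es. 1)"
    by (rule sum.swap_restrict) (simp_all add: E_def)
  also have "\<dots> = (\<Sum>es\<in>permutations_of_set E. real n - 1)"
  proof (rule sum.cong[OF refl])
    fix es assume es: "es \<in> permutations_of_set E"
    have sub: "greedy {} es \<subseteq> E"
      unfolding E_def by (rule forest_subset[OF forest_greedy_permutation]) (use es E_def in simp)
    then have "{e. e \<in> E \<and> e \<in> greedy {} es} = greedy {} es" by auto
    then show "(\<Sum>e | e \<in> E \<and> e \<in> greedy {} es. 1) = real n - 1"
      using card_greedy[of es n] es assms by (simp add: E_def)
  qed
  finally show ?thesis by (simp add: E_def)
qed

text \<open>By symmetry all n (n - 1) / 2 edges have the same count, and every order selects n - 1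
  edges in total.\<close>

lemma edge_count_eq:
  assumes "e \<in> complete_edges n"
  shows "edge_count n e = 2 * fact (card (complete_edges n)) / n"
proof -
  obtain a b where ab: "e = {a, b}" "a < n" "b < n" "a \<noteq> b"
    using assms by (rule complete_edgesE)
  have const: "edge_count n f = edge_count n e" if f: "f \<in> complete_edges n" for f
  proof -
    obtain c d where cd: "f = {c, d}" "c < n" "d < n" "c \<noteq> d"
      using f by (rule complete_edgesE)
    obtain p where p: "p permutes {..<n}" "map p [a, b] = [c, d]"
      using ex_permutes_map[of "[a, b]" "[c, d]" "{..<n}"] ab cd by auto
    then have "p ` e = f" using ab cd by simp
    then show ?thesis
      using pair_count_image[OF p(1), of e e] by (simp add: pair_count_self)
  qed
  have n: "1 < n" using ab by auto
  have "(real n - 1) * (real n * edge_count n e) = 2 * (real (card (complete_edges n)) * edge_count n e)"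
    by (simp add: card_complete_edges)
  also have "real (card (complete_edges n)) * edge_count n e = (\<Sum>f\<in>complete_edges n. edge_count n f)"
    by (simp add: const)
  also have "\<dots> = fact (card (complete_edges n)) * (real n - 1)"
    using n by (intro sum_edge_count) auto
  finally have "(real n - 1) * (real n * edge_count n e) = (real n - 1) * (2 * fact (card (complete_edges n)))"
    by simp
  then have "real n * edge_count n e = 2 * fact (card (complete_edges n))"
    using n by (subst (asm) mult_cancel_left) auto
  then show ?thesis using n by (simp add: field_simps)
qed

text \<open>All adjacent pairs have the same count, so it is the total of \<open>adjacencies\<close>
  over all orders divided by the number n (n - 1) (n - 2) of such pairs.\<close>

lemma pair_count_adjacent_le:
  assumes "(e, f) \<in> adjacent_pairs (complete_edges n)"
  shows "pair_count n e f \<le> 4 * fact (card (complete_edges n)) / (real n)\<^sup>2"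
proof -
  let ?E = "complete_edges n"
  have shape: "\<exists>a b c. g = {a, b} \<and> h = {a, c} \<and> distinct [a, b, c] \<and> {a, b, c} \<subseteq> {..<n}"
    if "(g, h) \<in> adjacent_pairs ?E" for g h
  proof -
    have other: "\<exists>b. e = {a, b} \<and> a \<noteq> b \<and> a < n \<and> b < n" if "e \<in> ?E" "a \<in> e" for e a
      using that by (elim complete_edgesE) auto
    from that obtain a where a: "a \<in> g" "a \<in> h" "g \<in> ?E" "h \<in> ?E" "g \<noteq> h"
      by (auto simp: adjacent_pairs_def)
    obtain b where b: "g = {a, b}" "a \<noteq> b" "a < n" "b < n" using other a by blast
    obtain c where c: "h = {a, c}" "a \<noteq> c" "c < n" using other a by blast
    have "b \<noteq> c" using a(5) b(1) c(1) by blast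
    then show ?thesis using b c by (intro exI[of _ a] exI[of _ b] exI[of _ c]) simp
  qed
  obtain a b c where abc: "e = {a, b}" "f = {a, c}" "distinct [a, b, c]" "{a, b, c} \<subseteq> {..<n}"
    using shape[OF assms] by blast
  have const: "pair_count n g h = pair_count n e f" if gh: "(g, h) \<in> adjacent_pairs ?E" for g h
  proof -
    obtain a' b' c' where abc': "g = {a', b'}" "h = {a', c'}" "distinct [a', b', c']" "{a', b', c'} \<subseteq> {..<n}"
      using shape[OF gh] by blast
    obtain p where p: "p permutes {..<n}" "map p [a, b, c] = [a', b', c']"
      using ex_permutes_map[of "[a, b, c]" "[a', b', c']" "{..<n}"] abc abc' by auto
    then have "p ` e = g" "p ` f = h" using abc abc' by auto
    then show ?thesis
      using pair_count_image[OF p(1), of e f] by simp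
  qed
  \<comment> \<open>Three distinct vertices make (n - 1) (n - 2) positive, so that it can be
    cancelled below.\<close>
  have "card {a, b, c} \<le> card {..<n}" by (rule card_mono) (use abc in auto)
  then have n: "3 \<le> n" using abc by simp
  have "real (card (adjacent_pairs ?E)) * pair_count n e f = (\<Sum>(g, h)\<in>adjacent_pairs ?E. pair_count n g h)"
    using const by (simp add: case_prod_beta)
  also have "\<dots> = (\<Sum>es\<in>permutations_of_set ?E. adjacencies n (greedy {} es))"
    unfolding sum_pair_count[OF finite_adjacent_pairs[OF finite_complete_edges]]
  proof (rule sum.cong[OF refl])
    fix es assume es: "es \<in> permutations_of_set ?E"
    have sub: "greedy {} es \<subseteq> ?E" by (rule forest_subset[OF forest_greedy_permutation[OF es]])
    then have "{(g, h) \<in> adjacent_pairs ?E. g \<in> greedy {} es \<and> h \<in> greedy {} es} = adjacent_pairs (greedy {} es)"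
      by (auto simp: adjacent_pairs_def)
    then show "real (card {(g, h) \<in> adjacent_pairs ?E. g \<in> greedy {} es \<and> h \<in> greedy {} es}) =
        adjacencies n (greedy {} es)"
      using card_adjacent_pairs[OF sub] by simp
  qed
  also have "\<dots> \<le> fact (card ?E) * (4 * (real n - 1) * (real n - 2) / n)"
    using n by (intro sum_adjacencies_greedy) auto
  also have "\<dots> = ((real n - 1) * (real n - 2)) * (4 * fact (card ?E) / n)"
    by (simp only: times_divide_eq_right ac_simps)
  finally have "((real n - 1) * (real n - 2)) * (n * pair_count n e f) \<le>
      ((real n - 1) * (real n - 2)) * (4 * fact (card ?E) / n)"
    unfolding card_adjacent_pairs[OF subset_refl] adjacencies_complete_edges by (simp only: ac_simps)
  then have "n * pair_count n e f \<le> 4 * fact (card ?E) / n"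
    using n by (subst (asm) mult_le_cancel_left_pos) auto
  then show ?thesis using n by (simp add: field_simps power2_eq_square)
qed

text \<open>A tree has (n - 1) (n - 2) ordered pairs of distinct edges, and those not adjacent are
  disjoint. Hence the lower bound on \<open>adjacencies\<close> bounds this count from
  above.\<close>

lemma pair_count_disjoint_le:
  assumes "(e, f) \<in> disjoint_pairs (complete_edges n)"
  shows "pair_count n e f \<le> 4 * fact (card (complete_edges n)) / (real n)\<^sup>2"
proof -
  let ?E = "complete_edges n"
  have shape: "\<exists>a b c d. g = {a, b} \<and> h = {c, d} \<and> distinct [a, b, c, d] \<and> {a, b, c, d} \<subseteq> {..<n}"
    if gh: "(g, h) \<in> disjoint_pairs ?E" for g h
  proof -
    have "g \<in> ?E" "h \<in> ?E" "g \<inter> h = {}" using gh by (auto simp: disjoint_pairs_def)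
    then show ?thesis by (elim complete_edgesE) auto
  qed
  obtain a b c d where abcd: "e = {a, b}" "f = {c, d}" "distinct [a, b, c, d]" "{a, b, c, d} \<subseteq> {..<n}"
    using shape[OF assms] by blast
  have const: "pair_count n g h = pair_count n e f" if gh: "(g, h) \<in> disjoint_pairs ?E" for g h
  proof -
    obtain a' b' c' d' where abcd': "g = {a', b'}" "h = {c', d'}" "distinct [a', b', c', d']"
      "{a', b', c', d'} \<subseteq> {..<n}"
      using shape[OF gh] by blast
    obtain p where p: "p permutes {..<n}" "map p [a, b, c, d] = [a', b', c', d']"
      using ex_permutes_map[of "[a, b, c, d]" "[a', b', c', d']" "{..<n}"] abcd abcd' by auto
    then have "p ` e = g" "p ` f = h" using abcd abcd' by auto
    then show ?thesis
      using pair_count_image[OF p(1), of e f] by simp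
  qed
  \<comment> \<open>Four distinct vertices make the factor n - 3 positive for the
    cancellation.\<close>
  have "card {a, b, c, d} \<le> card {..<n}" by (rule card_mono) (use abcd in auto)
  then have n: "4 \<le> n" using abcd by simp
  let ?N = "fact (card ?E) :: real"
  have "real (card (disjoint_pairs ?E)) * pair_count n e f = (\<Sum>(g, h)\<in>disjoint_pairs ?E. pair_count n g h)"
    using const by (simp add: case_prod_beta)
  also have "\<dots> = (\<Sum>es\<in>permutations_of_set ?E. (real n - 1) * (real n - 2) - adjacencies n (greedy {} es))"
    unfolding sum_pair_count[OF finite_disjoint_pairs[OF finite_complete_edges]]
  proof (rule sum.cong[OF refl])
    fix es assume es: "es \<in> permutations_of_set ?E"
    have sub: "greedy {} es \<subseteq> ?E" by (rule forest_subset[OF forest_greedy_permutation[OF es]])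
    then have "{(g, h) \<in> disjoint_pairs ?E. g \<in> greedy {} es \<and> h \<in> greedy {} es} = disjoint_pairs (greedy {} es)"
      by (auto simp: disjoint_pairs_def)
    then show "real (card {(g, h) \<in> disjoint_pairs ?E. g \<in> greedy {} es \<and> h \<in> greedy {} es}) =
        (real n - 1) * (real n - 2) - adjacencies n (greedy {} es)"
      using card_disjoint_pairs[OF sub] card_greedy[OF es] n by simp
  qed
  also have "\<dots> = ?N * ((real n - 1) * (real n - 2)) -
      (\<Sum>es\<in>permutations_of_set ?E. adjacencies n (greedy {} es))"
    by (simp add: sum_subtractf)
  also have "\<dots> \<le> ?N * ((real n - 1) * (real n - 2)) - ?N * (3 * (real n - 1) * (real n - 2) / n)"
    using n by (intro diff_left_mono sum_adjacencies_greedy) auto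
  also have "\<dots> = ((real n - 1) * (real n - 2) * (real n - 3)) * (?N / n)"
    using n by (simp add: field_simps)
  finally have "real (card (disjoint_pairs ?E)) * pair_count n e f \<le>
      ((real n - 1) * (real n - 2) * (real n - 3)) * (?N / n)" .
  moreover have "real (card (disjoint_pairs ?E)) = ((real n - 1) * (real n - 2) * (real n - 3)) * (n / 4)"
    unfolding card_disjoint_pairs[OF subset_refl] card_complete_edges adjacencies_complete_edges
    by (simp add: field_simps)
  ultimately have "((real n - 1) * (real n - 2) * (real n - 3)) * (n / 4 * pair_count n e f) \<le>
      ((real n - 1) * (real n - 2) * (real n - 3)) * (?N / n)"
    by (simp only: mult.assoc)
  then have "n / 4 * pair_count n e f \<le> ?N / n"
    using n by (subst (asm) mult_le_cancel_left_pos) auto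
  then show ?thesis using n by (simp add: field_simps power2_eq_square)
qed

text \<open>Both kinds of pairs have probability at most 4/n^2, which is the square of the edge
  probability 2/n.\<close>

lemma pair_count_negative_correlation:
  assumes "e \<in> complete_edges n" "f \<in> complete_edges n" "e \<noteq> f"
  shows "pair_count n e f / fact (card (complete_edges n)) \<le>
     (edge_count n e / fact (card (complete_edges n))) * (edge_count n f / fact (card (complete_edges n)))"
proof -
  have "(e, f) \<in> adjacent_pairs (complete_edges n) \<or> (e, f) \<in> disjoint_pairs (complete_edges n)"
    using assms by (auto simp: adjacent_pairs_def disjoint_pairs_def)
  then have "pair_count n e f \<le> 4 * fact (card (complete_edges n)) / (real n)\<^sup>2"
    using pair_count_adjacent_le pair_count_disjoint_le by blast
  then have "pair_count n e f / fact (card (complete_edges n)) \<le>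
      4 * fact (card (complete_edges n)) / (real n)\<^sup>2 / fact (card (complete_edges n))"
    by (rule divide_right_mono) simp
  also have "\<dots> = (edge_count n e / fact (card (complete_edges n))) * (edge_count n f / fact (card (complete_edges n)))"
    using assms by (simp add: edge_count_eq power2_eq_square)
  finally show ?thesis .
qed

section \<open>Order statistics of independent atomless weights\<close>

text \<open>A subset of a singleton is empty or everything, so it cannot have strictly intermediate
  measure.\<close>

lemma atomless_singleton:
  assumes "atomless \<mu>" "sets \<mu> = sets (borel :: real measure)"
  shows "emeasure \<mu> {x} = 0"
proof (rule ccontr)
  assume "emeasure \<mu> {x} \<noteq> 0"
  then have "0 < emeasure \<mu> {x}" by (simp add: zero_less_iff_neq_zero)
  moreover have "{x} \<in> sets \<mu>" using assms(2) by simp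
  ultimately obtain B where "B \<subseteq> {x}" "0 < emeasure \<mu> B" "emeasure \<mu> B < emeasure \<mu> {x}"
    using assms(1) by (auto simp: atomless_def)
  then show False by (auto simp: subset_singleton_iff)
qed

lemma measurable_sorted_wrt:
  fixes f :: "'i \<Rightarrow> 'a \<Rightarrow> real"
  assumes "\<And>i. i \<in> set xs \<Longrightarrow> f i \<in> borel_measurable N"
  shows "Measurable.pred N (\<lambda>x. sorted_wrt (\<lambda>i j. f i x < f j x) xs)"
  using assms
proof (induction xs)
  case (Cons i xs)
  have "Measurable.pred N (\<lambda>x. \<forall>j\<in>set xs. f i x < f j x)"
    using Cons.prems by (intro pred_intros_finite borel_measurable_pred_less) auto
  moreover have "Measurable.pred N (\<lambda>x. sorted_wrt (\<lambda>i j. f i x < f j x) xs)"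
    using Cons by auto
  ultimately show ?case by simp
qed simp

lemma sorted_wrt_less_cong:
  assumes "\<And>i. i \<in> set xs \<Longrightarrow> f i = g i"
  shows "sorted_wrt (\<lambda>i j. f i < f j) xs \<longleftrightarrow> sorted_wrt (\<lambda>i j. g i < g j) xs"
proof -
  have "map f xs = map g xs" using assms by simp
  then show ?thesis by (metis sorted_wrt_map)
qed

lemma ex_strictly_sorted_permutation:
  fixes w :: "'a \<Rightarrow> real"
  assumes "finite E" "inj_on w E"
  shows "\<exists>es\<in>permutations_of_set E. sorted_wrt (\<lambda>e g. w e < w g) es"
proof -
  obtain xs where xs: "set xs = E" "distinct xs"
    using assms(1) finite_distinct_list by auto
  let ?es = "sort_key w xs"
  have "distinct (map w ?es)"
    using assms(2) xs by (simp add: distinct_map)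
  then have "sorted_wrt (<) (map w ?es)"
    by (simp add: strict_sorted_iff)
  then show ?thesis
    using xs by (intro bexI[of _ ?es]) (auto simp: sorted_wrt_map)
qed

lemma strictly_sorted_permutation_unique:
  fixes w :: "'a \<Rightarrow> real"
  assumes "xs \<in> permutations_of_set E" "ys \<in> permutations_of_set E"
    and "sorted_wrt (\<lambda>e g. w e < w g) xs" "sorted_wrt (\<lambda>e g. w e < w g) ys"
  shows "xs = ys"
proof -
  have "sorted_wrt (<) (map w xs)" "sorted_wrt (<) (map w ys)"
    using assms by (simp_all add: sorted_wrt_map)
  then have s: "sorted (map w xs)" "distinct (map w xs)" "sorted (map w ys)" "distinct (map w ys)"
    by (auto simp: strict_sorted_iff)
  have "set xs = E" "set ys = E" using assms by (auto simp: permutations_of_setD)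
  then show ?thesis
    using s by (intro map_sorted_distinct_set_unique[of w]) (auto simp: distinct_map)
qed

text \<open>Nonemptiness of \<open>I\<close> ensures that \<open>\<mu>\<close> really is the law of
  some weight, hence a Borel probability measure.\<close>

locale iid_weights = prob_space M for M :: "'w measure" +
  fixes I :: "'i set" and X :: "'i \<Rightarrow> 'w \<Rightarrow> real" and \<mu> :: "real measure"
  assumes fin: "finite I" and nonempty: "I \<noteq> {}"
    and indep: "indep_vars (\<lambda>_. borel) X I"
    and distr: "\<And>i. i \<in> I \<Longrightarrow> distr M borel (X i) = \<mu>"
    and atomless: "atomless \<mu>"
begin

lemma measurable_X: "i \<in> I \<Longrightarrow> X i \<in> borel_measurable M"
  using indep by (auto simp: indep_vars_def)

lemma sets_\<mu>: "sets \<mu> = sets borel"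
  using nonempty distr by (metis ex_in_conv sets_distr)

lemma prob_space_\<mu>: "prob_space \<mu>"
  using nonempty distr measurable_X prob_space_distr by (metis ex_in_conv)

lemma distr_PiM: "distr M (\<Pi>\<^sub>M i\<in>I. borel) (\<lambda>\<omega>. \<lambda>i\<in>I. X i \<omega>) = (\<Pi>\<^sub>M i\<in>I. \<mu>)"
proof -
  have "distr M (\<Pi>\<^sub>M i\<in>I. borel) (\<lambda>\<omega>. \<lambda>i\<in>I. X i \<omega>) = (\<Pi>\<^sub>M i\<in>I. distr M borel (X i))"
    using indep indep_vars_iff_distr_eq_PiM'[OF nonempty measurable_X] by simp
  also have "\<dots> = (\<Pi>\<^sub>M i\<in>I. \<mu>)"
    by (intro PiM_cong refl distr)
  finally show ?thesis .
qed

text \<open>By independence the pair has law \<open>\<mu>\<close> times \<open>\<mu>\<close>, and by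
  Fubini the diagonal is null because points are null.\<close>

lemma AE_distinct:
  assumes ij: "i \<in> I" "j \<in> I" "i \<noteq> j"
  shows "AE \<omega> in M. X i \<omega> \<noteq> X j \<omega>"
proof -
  interpret \<mu>: prob_space \<mu> by (rule prob_space_\<mu>)
  interpret P: pair_prob_space \<mu> \<mu> ..
  have "indep_var borel (X i) borel (X j)"
  proof -
    \<comment> \<open>Independence of the two variables is read off from the subfamilies indexed by
      \<open>{i}\<close> and \<open>{j}\<close>.\<close>
    have "indep_var borel ((\<lambda>x. x i) \<circ> (\<lambda>\<omega>. \<lambda>k\<in>{i}. X k \<omega>)) borel ((\<lambda>x. x j) \<circ> (\<lambda>\<omega>. \<lambda>k\<in>{j}. X k \<omega>))"
      by (rule indep_var_compose[OF indep_var_restrict[OF indep]]) (use ij in auto)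
    then show ?thesis by (simp add: comp_def)
  qed
  then have joint: "\<mu> \<Otimes>\<^sub>M \<mu> = distr M (borel \<Otimes>\<^sub>M borel) (\<lambda>\<omega>. (X i \<omega>, X j \<omega>))"
    using ij by (simp add: indep_var_distribution_eq distr)
  have sets: "sets (\<mu> \<Otimes>\<^sub>M \<mu>) = sets (borel \<Otimes>\<^sub>M borel)"
    by (intro sets_pair_measure_cong sets_\<mu>)
  have "AE p in \<mu> \<Otimes>\<^sub>M \<mu>. fst p \<noteq> snd p"
  proof (rule P.AE_pair_measure)
    have "Measurable.pred (borel \<Otimes>\<^sub>M borel) (\<lambda>p :: real \<times> real. fst p \<noteq> snd p)"
      by measurable
    then show "{p \<in> space (\<mu> \<Otimes>\<^sub>M \<mu>). fst p \<noteq> snd p} \<in> sets (\<mu> \<Otimes>\<^sub>M \<mu>)"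
      by (simp add: pred_def sets sets_eq_imp_space_eq[OF sets])
    have "AE y in \<mu>. x \<noteq> y" for x
      using atomless_singleton[OF atomless sets_\<mu>, of x] sets_\<mu>
      by (intro AE_I[of _ _ "{x}"]) auto
    then show "AE x in \<mu>. AE y in \<mu>. fst (x, y) \<noteq> snd (x, y)" by simp
  qed
  then show ?thesis
    unfolding joint using ij measurable_X by (subst (asm) AE_distr_iff) auto
qed

lemma AE_inj_on: "AE \<omega> in M. inj_on (\<lambda>i. X i \<omega>) I"
proof -
  have "AE \<omega> in M. \<forall>i\<in>I. \<forall>j\<in>I. i \<noteq> j \<longrightarrow> X i \<omega> \<noteq> X j \<omega>"
    using fin AE_distinct by (intro AE_finite_allI) auto
  then show ?thesis by (auto elim!: eventually_mono simp: inj_on_def)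
qed

definition sorted_event :: "'i list \<Rightarrow> 'w set" where
  "sorted_event xs = {\<omega> \<in> space M. sorted_wrt (\<lambda>i j. X i \<omega> < X j \<omega>) xs}"

lemma sorted_event_measurable: "xs \<in> permutations_of_set I \<Longrightarrow> sorted_event xs \<in> events"
  using measurable_sorted_wrt[of xs X M] measurable_X
  by (auto simp: sorted_event_def pred_def permutations_of_setD)

text \<open>Exchangeability: the joint law is a power of \<open>\<mu>\<close>, which is invariant
  under permuting coordinates, and some permutation carries \<open>xs\<close> to
  \<open>ys\<close>.\<close>

lemma prob_sorted_event_cong:
  assumes xs: "xs \<in> permutations_of_set I" and ys: "ys \<in> permutations_of_set I"
  shows "prob (sorted_event xs) = prob (sorted_event ys)"
proof -
  define N where "N = (\<Pi>\<^sub>M i\<in>I. \<mu>)"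
  define B where "B zs = {x \<in> space N. sorted_wrt (\<lambda>i j. x i < x j) zs}" for zs
  have setsN: "sets N = sets (\<Pi>\<^sub>M i\<in>I. borel)"
    unfolding N_def by (intro sets_PiM_cong refl) (simp add: sets_\<mu>)
  have spaceN: "space N = space (\<Pi>\<^sub>M i\<in>I. borel)"
    using setsN by (rule sets_eq_imp_space_eq)
  have B: "B zs \<in> sets N" if "zs \<in> permutations_of_set I" for zs
  proof -
    have "Measurable.pred (\<Pi>\<^sub>M i\<in>I. borel) (\<lambda>x. sorted_wrt (\<lambda>i j. x i < (x j :: real)) zs)"
      using permutations_of_setD[OF that] by (intro measurable_sorted_wrt) auto
    then show ?thesis by (simp add: B_def pred_def setsN spaceN)
  qed
  have probB: "prob (sorted_event zs) = measure N (B zs)" if zs: "zs \<in> permutations_of_set I" for zs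
  proof -
    have m: "(\<lambda>\<omega>. \<lambda>i\<in>I. X i \<omega>) \<in> measurable M (\<Pi>\<^sub>M i\<in>I. borel)"
      by (intro measurable_restrict measurable_X)
    have "measure N (B zs) = prob ((\<lambda>\<omega>. \<lambda>i\<in>I. X i \<omega>) -` B zs \<inter> space M)"
      unfolding N_def distr_PiM[symmetric] using m B[OF zs] setsN by (subst measure_distr) auto
    also have "(\<lambda>\<omega>. \<lambda>i\<in>I. X i \<omega>) -` B zs \<inter> space M = sorted_event zs"
    proof -
      have "sorted_wrt (\<lambda>i j. (\<lambda>i\<in>I. X i \<omega>) i < (\<lambda>i\<in>I. X i \<omega>) j) zs \<longleftrightarrow>
          sorted_wrt (\<lambda>i j. X i \<omega> < X j \<omega>) zs" for \<omega>
        using permutations_of_setD[OF zs] by (intro sorted_wrt_less_cong) auto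
      then show ?thesis
        using measurable_space[OF m] by (auto simp: B_def sorted_event_def spaceN)
    qed
    finally show ?thesis ..
  qed
  obtain t where t: "t permutes I" "map t xs = ys"
    using ex_permutes_map[of xs ys I] permutations_of_setD[OF xs] permutations_of_setD[OF ys]
    by (metis distinct_card order_refl)
  have "distr N N (\<lambda>x. \<lambda>i\<in>I. x (t i)) = N"
    unfolding N_def
    using distr_PiM_reindex[of I "\<lambda>_. \<mu>" t I] prob_space_\<mu> permutes_inj_on[OF t(1)]
      permutes_in_image[OF t(1)] by auto
  then have "measure N (B xs) = measure (distr N N (\<lambda>x. \<lambda>i\<in>I. x (t i))) (B xs)" by simp
  also have "\<dots> = measure N ((\<lambda>x. \<lambda>i\<in>I. x (t i)) -` B xs \<inter> space N)"
  proof (rule measure_distr)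
    show "(\<lambda>x. \<lambda>i\<in>I. x (t i)) \<in> measurable N N"
      unfolding N_def using permutes_in_image[OF t(1)]
      by (intro measurable_restrict measurable_component_singleton) auto
  qed (rule B[OF xs])
  also have "(\<lambda>x. \<lambda>i\<in>I. x (t i)) -` B xs \<inter> space N = B ys"
  proof -
    have "(\<lambda>i\<in>I. x (t i)) \<in> space N" if "x \<in> space N" for x
      using that permutes_in_image[OF t(1)] by (auto simp: N_def space_PiM)
    moreover have "sorted_wrt (\<lambda>i j. (\<lambda>i\<in>I. x (t i)) i < (\<lambda>i\<in>I. x (t i)) j) xs \<longleftrightarrow>
        sorted_wrt (\<lambda>i j. x i < x j) ys" for x :: "'i \<Rightarrow> real"
      using permutations_of_setD[OF xs]
      by (subst sorted_wrt_less_cong[of xs _ "\<lambda>i. x (t i)"]) (auto simp: t(2)[symmetric] sorted_wrt_map)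
    ultimately show ?thesis by (auto simp: B_def)
  qed
  finally show ?thesis by (simp add: probB xs ys)
qed

text \<open>The events for different orders are disjoint, equally likely, and cover almost
  everything since ties have probability zero.\<close>

lemma prob_UN_sorted_event:
  assumes "S \<subseteq> permutations_of_set I"
  shows "prob (\<Union>xs\<in>S. sorted_event xs) = card S / fact (card I)"
proof -
  have sum: "prob (\<Union>xs\<in>S. sorted_event xs) = (\<Sum>xs\<in>S. prob (sorted_event xs))"
    if S: "S \<subseteq> permutations_of_set I" for S
  proof (rule finite_measure_finite_Union)
    show "finite S" using S finite_permutations_of_set by (rule finite_subset)
    show "sorted_event ` S \<subseteq> events" using S sorted_event_measurable by auto
    show "disjoint_family_on sorted_event S"
      unfolding disjoint_family_on_def
    proof (intro ballI impI equals0I)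
      fix ks js \<omega> assume "ks \<in> S" "js \<in> S" "ks \<noteq> js" "\<omega> \<in> sorted_event ks \<inter> sorted_event js"
      then show False
        using S strictly_sorted_permutation_unique[of ks I js "\<lambda>i. X i \<omega>"]
        by (auto simp: sorted_event_def)
    qed
  qed
  obtain js where js: "js \<in> permutations_of_set I"
    using finite_distinct_list[OF fin] by blast
  have const: "prob (\<Union>xs\<in>S. sorted_event xs) = card S * prob (sorted_event js)"
    if S: "S \<subseteq> permutations_of_set I" for S
    unfolding sum[OF S] using S prob_sorted_event_cong[OF _ js] by (simp add: subset_eq)
  have "prob (\<Union>xs\<in>permutations_of_set I. sorted_event xs) = 1"
  proof (subst prob_eq_1)
    show "(\<Union>xs\<in>permutations_of_set I. sorted_event xs) \<in> events"
      using sorted_event_measurable by (intro sets.finite_UN) auto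
    show "AE \<omega> in M. \<omega> \<in> (\<Union>xs\<in>permutations_of_set I. sorted_event xs)"
      using AE_inj_on AE_space
    proof eventually_elim
      case (elim \<omega>)
      then show ?case
        using ex_strictly_sorted_permutation[OF fin, of "\<lambda>i. X i \<omega>"] by (auto simp: sorted_event_def)
    qed
  qed
  then have "fact (card I) * prob (sorted_event js) = 1"
    using const[OF subset_refl] fin by simp
  then have "prob (sorted_event js) = 1 / fact (card I)"
    by (simp add: field_simps)
  then show ?thesis using const[OF assms] by simp
qed

end

section \<open>Transfer from edge orders to the random minimum spanning tree\<close>

theorem corollaryB3:
  fixes n :: nat
    and M :: "'w measure"
    and \<mu> :: "real measure"
    and X :: "nat set \<Rightarrow> 'w \<Rightarrow> real"
    and T :: "'w \<Rightarrow> nat set set"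
  assumes "3 \<le> n"
    and "prob_space M"
    and "prob_space.indep_vars M (\<lambda>_. borel) X (complete_edges n)"
    and "\<And>e. e \<in> complete_edges n \<Longrightarrow> distr M borel (X e) = \<mu>"
    and "atomless \<mu>"
    and "T \<in> measurable M (count_space (Pow (complete_edges n)))"
    and "AE \<omega> in M. is_min_spanning_tree n (\<lambda>e. X e \<omega>) (T \<omega>)"
  shows "(AE \<omega> in M. \<exists>!F. is_min_spanning_tree n (\<lambda>e. X e \<omega>) F) \<and>
    (\<forall>e\<in>complete_edges n. \<forall>f\<in>complete_edges n. e \<noteq> f \<longrightarrow>
       \<P>(\<omega> in M. e \<in> T \<omega> \<and> f \<in> T \<omega>) \<le> \<P>(\<omega> in M. e \<in> T \<omega>) * \<P>(\<omega> in M. f \<in> T \<omega>))"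
proof -
  let ?E = "complete_edges n"
  have "{0, 1} \<in> ?E" using assms(1) by (simp add: pair_in_complete_edges)
  then interpret iid_weights M ?E X \<mu>
    using assms by (intro iid_weights.intro iid_weights_axioms.intro) auto
  have uniq: "AE \<omega> in M. \<exists>!F. is_min_spanning_tree n (\<lambda>e. X e \<omega>) F"
    using AE_inj_on assms(7)
  proof eventually_elim
    case (elim \<omega>)
    show ?case
    proof (rule ex1I)
      show "is_min_spanning_tree n (\<lambda>e. X e \<omega>) (T \<omega>)" by (rule elim(2))
    next
      fix F assume "is_min_spanning_tree n (\<lambda>e. X e \<omega>) F"
      then show "F = T \<omega>"
        by (rule trans[OF min_spanning_tree_eq[OF _ elim(1)] min_spanning_tree_eq[OF elim(2,1), symmetric]])
    qed
  qed
  \<comment> \<open>With distinct weights, the tree and the output of Kruskal's algorithm on the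
    sorted order satisfy the same lighter-edge criterion.\<close>
  have T_greedy: "AE \<omega> in M. \<forall>es\<in>permutations_of_set ?E. \<omega> \<in> sorted_event es \<longrightarrow> T \<omega> = greedy {} es"
    using AE_inj_on assms(7)
  proof eventually_elim
    case (elim \<omega>)
    have "T \<omega> = {e \<in> ?E. \<not> edges_connect e {g \<in> ?E. X g \<omega> < X e \<omega>}}"
      by (rule min_spanning_tree_eq[OF elim(2,1)])
    then show ?case
      using greedy_sorted[where n = n and w = "\<lambda>e. X e \<omega>"]
      by (auto simp: sorted_event_def permutations_of_setD)
  qed
  \<comment> \<open>The whole law of \<open>T\<close> is that of Kruskal's output on a uniformly
    random order; three choices of \<open>Q\<close> then give the three probabilities.\<close>
  have law: "\<P>(\<omega> in M. Q (T \<omega>)) = card {es \<in> permutations_of_set ?E. Q (greedy {} es)} / fact (card ?E)"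
    for Q
  proof -
    let ?S = "{es \<in> permutations_of_set ?E. Q (greedy {} es)}"
    have "\<P>(\<omega> in M. Q (T \<omega>)) = prob (\<Union>es\<in>?S. sorted_event es)"
    proof (rule finite_measure_eq_AE)
      show "AE \<omega> in M. \<omega> \<in> {\<omega> \<in> space M. Q (T \<omega>)} \<longleftrightarrow> \<omega> \<in> (\<Union>es\<in>?S. sorted_event es)"
        using T_greedy AE_inj_on AE_space
      proof eventually_elim
        case (elim \<omega>)
        obtain es where es: "es \<in> permutations_of_set ?E" "\<omega> \<in> sorted_event es"
          using ex_strictly_sorted_permutation[OF fin elim(2)] elim(3) by (auto simp: sorted_event_def)
        have T: "T \<omega> = greedy {} fs" if "fs \<in> permutations_of_set ?E" "\<omega> \<in> sorted_event fs" for fs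
          using elim(1) that by blast
        show ?case
        proof
          assume "\<omega> \<in> {\<omega> \<in> space M. Q (T \<omega>)}"
          then show "\<omega> \<in> (\<Union>es\<in>?S. sorted_event es)"
            using es T[OF es] by auto
        next
          assume "\<omega> \<in> (\<Union>es\<in>?S. sorted_event es)"
          then obtain fs where "fs \<in> ?S" "\<omega> \<in> sorted_event fs" by blast
          then show "\<omega> \<in> {\<omega> \<in> space M. Q (T \<omega>)}"
            using T[of fs] elim(3) by simp
        qed
      qed
      \<comment> \<open>Since \<open>T\<close> takes values in \<open>Pow ?E\<close>, the arbitrary
        predicate \<open>Q\<close> may be cut down to a set of the discrete target space.\<close>
      have "{\<omega> \<in> space M. Q (T \<omega>)} = T -` {F \<in> Pow ?E. Q F} \<inter> space M"
        using measurable_space[OF assms(6)] by auto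
      moreover have "{F \<in> Pow ?E. Q F} \<in> sets (count_space (Pow ?E))" by auto
      ultimately show "{\<omega> \<in> space M. Q (T \<omega>)} \<in> events"
        using measurable_sets[OF assms(6)] by (simp only:)
      show "(\<Union>es\<in>?S. sorted_event es) \<in> events"
        using sorted_event_measurable by (intro sets.finite_UN) auto
    qed
    then show ?thesis by (simp add: prob_UN_sorted_event)
  qed
  have "\<P>(\<omega> in M. e \<in> T \<omega> \<and> f \<in> T \<omega>) \<le> \<P>(\<omega> in M. e \<in> T \<omega>) * \<P>(\<omega> in M. f \<in> T \<omega>)"
    if "e \<in> ?E" "f \<in> ?E" "e \<noteq> f" for e f
    using pair_count_negative_correlation[OF that]
      law[of "\<lambda>F. e \<in> F \<and> f \<in> F"] law[of "\<lambda>F. e \<in> F"] law[of "\<lambda>F. f \<in> F"]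
    by (simp add: pair_count_def edge_count_def)
  then show ?thesis using uniq by blast
qed

end
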